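(* Let $\{\alpha_n\}_{n\ge 0}$, $\{\gamma_n\}_{n\ge 0}$ be real sequences with $\alpha_0=0$ and $\gamma_n>0$, $\alpha_{n+1}>0$ for all $n\ge 0$. Put $\beta_n=\alpha_n+\gamma_n$ and $\lambda_n=\sqrt{\alpha_{n+1}\gamma_n}$ for $n\ge 0$, and $h(0)=1$, $h(n)=\dfrac{\gamma_0\gamma_1\cdots\gamma_{n-1}}{\alpha_1\alpha_2\cdots\alpha_n}$ for $n\ge 1$. Let $\{R_n\}_{n\ge 0}$ be the polynomials defined by $R_0(x)\equiv 1$ and $$xR_n(x)=-\gamma_nR_{n+1}(x)+\beta_nR_n(x)-\alpha_nR_{n-1}(x),\qquad n\ge 0.$$ Assume there are constants $q,\kappa,s,c$ and $N$ such that \begin{align*} &\alpha_n\approx q^n,\quad \gamma_n\approx q^n, && 0<q<1,\\ &\alpha_n\le \kappa\gamma_n \ \ (n\ge 0), && 1\le\kappa<q^{-1}+q-1,\\ &h(n)\sim s^n, && s>1,\\ &\lambda_n\le \beta_{n+1}-c\,\beta_{n+2}\ \ (n\ge 0), && \frac{1+q}{1+q^2}<c<\frac1q,\\ &\beta_1\le\beta_0,\\ &\beta_n-c\,\beta_{n+1}\ge \beta_{n+1}-c\,\beta_{n+2}, && n\ge N. \end{align*} Let $\mu$ be the orthogonality measure of $\{R_n\}_{n\ge 0}$ and $S=\operatorname{supp}\mu$. For $f\in C(S)$ let $$a_k(f)=\int_S f(y)R_k(y)\,d\mu(y),\qquad s_n(f,x)=\sum_{k=0}^n a_k(f)R_k(x)h(k).$$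 Then for any $f\in C(S)$ the partial sums $s_n(f,x)$ converge to $f$ uniformly on $S$ as $n\to\infty$.
   Context: Notation: $a_n\approx b_n$ means that the ratio $a_n/b_n$ has a positive (finite) limit as $n\to\infty$; $a_n\sim b_n$ means that the ratio $a_n/b_n$ is positive, bounded, and bounded away from zero. $C(S)$ is the space of continuous functions on $S$. For $n=0$ the term $\alpha_0R_{-1}$ in the recurrence is zero, so the polynomials satisfy $R_n(0)=1$ for all $n$. The polynomials $p_n(x)=\sqrt{h(n)}\,R_n(x)$ satisfy $xp_n=-\lambda_np_{n+1}+\beta_np_n-\lambda_{n-1}p_{n-1}$. The orthogonality measure $\mu$ is the Borel probability measure on $\mathbb{R}$ for which the $p_n$ are orthonormal, i.e. $\int p_np_m\,d\mu=\delta_{nm}$ for all $n,m\ge 0$; it is uniquely determined because the recurrence coefficients are bounded, and its support $S$ is a compact subset of $[0,+\infty)$. *)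

theory Defs
  imports "HOL-Probability.Probability" "HOL-Computational_Algebra.Polynomial"
begin

definition ratio_converges :: "(nat \<Rightarrow> real) \<Rightarrow> (nat \<Rightarrow> real) \<Rightarrow> bool" where
  "ratio_converges a b \<longleftrightarrow> (\<exists>L>0. (\<lambda>n. a n / b n) \<longlonglongrightarrow> L)"

definition ratio_bounded :: "(nat \<Rightarrow> real) \<Rightarrow> (nat \<Rightarrow> real) \<Rightarrow> bool" where
  "ratio_bounded a b \<longleftrightarrow> (\<exists>m>0. \<exists>M. \<forall>n. m \<le> a n / b n \<and> a n / b n \<le> M)"

definition weight :: "(nat \<Rightarrow> real) \<Rightarrow> (nat \<Rightarrow> real) \<Rightarrow> nat \<Rightarrow> real" where
  "weight \<alpha> \<gamma> n = (\<Prod>i<n. \<gamma> i) / (\<Prod>i=1..n. \<alpha> i)"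

(* The three-term recurrence solved for its highest term; the case n = 0 uses alpha_0 = 0.
   The lemma orth_poly_recurrence below recovers the recurrence itself. *)
fun orth_poly :: "(nat \<Rightarrow> real) \<Rightarrow> (nat \<Rightarrow> real) \<Rightarrow> nat \<Rightarrow> real poly" where
  "orth_poly \<alpha> \<gamma> 0 = 1"
| "orth_poly \<alpha> \<gamma> (Suc 0) = smult (1 / \<gamma> 0) [:\<alpha> 0 + \<gamma> 0, -1:]"
| "orth_poly \<alpha> \<gamma> (Suc (Suc n)) =
     smult (1 / \<gamma> (Suc n))
       ([:\<alpha> (Suc n) + \<gamma> (Suc n), -1:] * orth_poly \<alpha> \<gamma> (Suc n)
        - smult (\<alpha> (Suc n)) (orth_poly \<alpha> \<gamma> n))"

lemma orth_poly_recurrence: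
  assumes "\<alpha> 0 = 0" and "\<gamma> n \<noteq> 0"
  shows "x * poly (orth_poly \<alpha> \<gamma> n) x =
           - \<gamma> n * poly (orth_poly \<alpha> \<gamma> (n + 1)) x
           + (\<alpha> n + \<gamma> n) * poly (orth_poly \<alpha> \<gamma> n) x
           - \<alpha> n * poly (orth_poly \<alpha> \<gamma> (n - 1)) x"
  using assms by (cases n) (simp_all add: algebra_simps)

definition orthonormal_poly :: "(nat \<Rightarrow> real) \<Rightarrow> (nat \<Rightarrow> real) \<Rightarrow> nat \<Rightarrow> real \<Rightarrow> real" where
  "orthonormal_poly \<alpha> \<gamma> n x = sqrt (weight \<alpha> \<gamma> n) * poly (orth_poly \<alpha> \<gamma> n) x"

definition orthogonality_measure ::
    "(nat \<Rightarrow> real) \<Rightarrow> (nat \<Rightarrow> real) \<Rightarrow> real measure \<Rightarrow> bool" where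
  "orthogonality_measure \<alpha> \<gamma> \<mu> \<longleftrightarrow>
     prob_space \<mu> \<and> sets \<mu> = sets borel \<and>
     (\<forall>n m. has_bochner_integral \<mu>
        (\<lambda>x. orthonormal_poly \<alpha> \<gamma> n x * orthonormal_poly \<alpha> \<gamma> m x) (if n = m then 1 else 0))"

definition supp :: "'a::topological_space measure \<Rightarrow> 'a set" where
  "supp \<mu> = {x. \<forall>U. open U \<longrightarrow> x \<in> U \<longrightarrow> emeasure \<mu> U > 0}"

(* The sort {real_normed_field, euclidean_space} makes the scalar field either real or complex. *)
definition fourier_coeff ::
    "(nat \<Rightarrow> real) \<Rightarrow> (nat \<Rightarrow> real) \<Rightarrow> real measure \<Rightarrow>
     (real \<Rightarrow> 'a::{real_normed_field,euclidean_space}) \<Rightarrow> nat \<Rightarrow> 'a" where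
  "fourier_coeff \<alpha> \<gamma> \<mu> f k =
     set_lebesgue_integral \<mu> (supp \<mu>) (\<lambda>y. f y * of_real (poly (orth_poly \<alpha> \<gamma> k) y))"

definition partial_sum ::
    "(nat \<Rightarrow> real) \<Rightarrow> (nat \<Rightarrow> real) \<Rightarrow> real measure \<Rightarrow>
     (real \<Rightarrow> 'a::{real_normed_field,euclidean_space}) \<Rightarrow> nat \<Rightarrow> real \<Rightarrow> 'a" where
  "partial_sum \<alpha> \<gamma> \<mu> f n x =
     (\<Sum>k=0..n. fourier_coeff \<alpha> \<gamma> \<mu> f k * of_real (poly (orth_poly \<alpha> \<gamma> k) x)
                * of_real (weight \<alpha> \<gamma> k))"

end

theory Submission
  imports Defs
begin

text \<open>By Stone--Weierstrass it suffices to bound \<open>\<integral>\<bar>K n x y\<bar> d\<mu>(y)\<close> uniformly in \<open>n\<close> and \<open>x \<in> S\<close>, where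
  \<open>K n x y = (\<Sum>m\<le>n. R m x * R m y * h m)\<close>. The size of \<open>R n x\<close> is governed by the ratio \<open>x / q ^ n\<close>.
  While \<open>x / q ^ n\<close> is bounded, summing the recurrence gives \<open>\<bar>R n x - 1\<bar> \<le> C * x / q ^ n\<close>. Once \<open>x / q ^ n\<close>
  is large, \<open>h n * R n x\<close> either halves at every step or grows geometrically from some step on; by
  Fatou's lemma the points of growth form an open \<open>\<mu>\<close>-null set, so points of the support always
  decay. The two regimes together bound \<open>h n * \<integral>\<bar>R n\<bar> d\<mu>\<close>. Then \<open>K n x\<close> is compared with \<open>K n 0\<close>, which
  telescopes, if \<open>x \<le> X * q ^ n\<close>, and otherwise with \<open>K k x\<close> for the \<open>k < n\<close> at which \<open>x\<close> is of order
  \<open>q ^ k\<close>.\<close>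

section \<open>The support of a Borel measure\<close>

text \<open>The complement of the support is the union of those members of a countable basis that
  have measure zero; countability makes the union null, and it is open as a union of open
  sets.\<close>

lemma supp_complement_null:
  fixes \<mu> :: "'a::second_countable_topology measure"
  assumes "sets \<mu> = sets borel"
  shows "- supp \<mu> \<in> null_sets \<mu>" and "closed (supp \<mu>)"
proof -
  obtain \<B> :: "'a set set" where \<B>: "countable \<B>" "topological_basis \<B>"
    using ex_countable_basis by blast
  let ?N = "{U \<in> \<B>. emeasure \<mu> U = 0}"
  have opn: "open U" if "U \<in> \<B>" for U
    using \<B>(2) that by (rule topological_basis_open)
  have eq: "- supp \<mu> = \<Union>?N"
  proof (intro equalityI subsetI)
    fix x assume "x \<in> - supp \<mu>"
    then obtain U where U: "open U" "x \<in> U" "emeasure \<mu> U = 0"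
      by (auto simp: supp_def zero_less_iff_neq_zero)
    obtain V where V: "V \<in> \<B>" "x \<in> V" "V \<subseteq> U"
      using topological_basisE[OF \<B>(2) U(1,2)] by blast
    have "U \<in> sets \<mu>"
      using U(1) assms by simp
    then have "emeasure \<mu> V = 0"
      using emeasure_mono[OF V(3)] U(3) by (metis le_zero_eq)
    with V show "x \<in> \<Union>?N" by blast
  next
    fix x assume "x \<in> \<Union>?N"
    then show "x \<in> - supp \<mu>"
      using opn by (fastforce simp: supp_def)
  qed
  show "- supp \<mu> \<in> null_sets \<mu>"
    unfolding eq
  proof (rule null_sets_UN'[where I = ?N and N = id, simplified])
    show "countable ?N" using \<B>(1) by simp
    show "U \<in> null_sets \<mu>" if "U \<in> \<B> \<and> emeasure \<mu> U = 0" for U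
      using that opn[of U] assms by (simp add: null_sets_def)
  qed
  show "closed (supp \<mu>)"
    unfolding closed_def eq using opn by blast
qed

section \<open>The recurrence under geometric bounds on its coefficients\<close>

lemma weight_0 [simp]: "weight \<alpha> \<gamma> 0 = 1"
  by (simp add: weight_def)

lemma weight_Suc: "weight \<alpha> \<gamma> (Suc n) = weight \<alpha> \<gamma> n * \<gamma> n / \<alpha> (Suc n)"
  by (simp add: weight_def)

text \<open>The asymptotic relations enter as inequalities valid for every \<open>n\<close>, so that
  all later constants are built from \<open>A\<close>, \<open>a\<close>, \<open>B\<close>,
  \<open>b\<close>, \<open>q\<close> and \<open>s\<close>.\<close>

locale geometric_recurrence =
  fixes \<alpha> \<gamma> :: "nat \<Rightarrow> real" and q s A a B b :: real and \<mu> :: "real measure"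
  assumes \<alpha>_0: "\<alpha> 0 = 0"
    and \<gamma>_pos: "\<And>n. 0 < \<gamma> n"
    and \<alpha>_pos: "\<And>n. 0 < \<alpha> (Suc n)"
    and q_pos: "0 < q" and q_less_1: "q < 1"
    and s_gt_1: "1 < s"
    and \<alpha>_le: "\<And>n. \<alpha> n \<le> A * q ^ n"
    and \<gamma>_le: "\<And>n. \<gamma> n \<le> A * q ^ n"
    and a_pos: "0 < a" and \<gamma>_ge: "\<And>n. a * q ^ n \<le> \<gamma> n"
    and b_pos: "0 < b" and weight_ge: "\<And>n. b * s ^ n \<le> weight \<alpha> \<gamma> n"
    and weight_le: "\<And>n. weight \<alpha> \<gamma> n \<le> B * s ^ n"
    and orth: "orthogonality_measure \<alpha> \<gamma> \<mu>"
begin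

abbreviation "h \<equiv> weight \<alpha> \<gamma>"
abbreviation "R n x \<equiv> poly (orth_poly \<alpha> \<gamma> n) x"

sublocale prob_space \<mu>
  using orth by (simp add: orthogonality_measure_def)

lemma sets_\<mu> [measurable_cong]: "sets \<mu> = sets borel"
  using orth by (simp add: orthogonality_measure_def)

lemma h_pos: "0 < h n"
  using weight_ge[of n] b_pos s_gt_1 by (smt (verit) mult_pos_pos zero_less_power)

lemma A_pos: "0 < A"
  using \<gamma>_pos[of 0] \<gamma>_le[of 0] by simp

lemma B_ge_b: "b \<le> B" "0 < B"
  using weight_ge[of 0] weight_le[of 0] b_pos by auto

text \<open>Detailed balance: this identity makes the recurrence symmetric with respect to the
  weight \<open>h\<close>.\<close>

lemma h_\<gamma>: "h n * \<gamma> n = h (Suc n) * \<alpha> (Suc n)"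
  using \<alpha>_pos[of n] by (simp add: weight_Suc)

lemma R_Suc_Suc:
  "\<gamma> (Suc n) * R (Suc (Suc n)) x =
     (\<alpha> (Suc n) + \<gamma> (Suc n) - x) * R (Suc n) x - \<alpha> (Suc n) * R n x"
  using \<gamma>_pos[of "Suc n"] by (simp add: algebra_simps)

lemma R_1: "\<gamma> 0 * R (Suc 0) x = \<gamma> 0 - x"
  using \<gamma>_pos[of 0] \<alpha>_0 by (simp add: field_simps)

text \<open>Multiplied by \<open>h n\<close>, the recurrence equates the increment of
  \<open>\<gamma> n * h n * (R (Suc n) x - R n x)\<close> in \<open>n\<close> with
  \<open>- x * R n x * h n\<close>, by detailed balance; summation telescopes. The sum on the right
  is the kernel at the point 0.\<close>

lemma R_diff:
  "\<gamma> n * h n * (R (Suc n) x - R n x) = - x * (\<Sum>m\<le>n. R m x * h m)"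
proof (induction n)
  case 0
  then show ?case using R_1[of x] by (simp del: orth_poly.simps(2) add: algebra_simps)
next
  case (Suc n)
  have "\<gamma> (Suc n) * h (Suc n) * (R (Suc (Suc n)) x - R (Suc n) x)
      = h (Suc n) * (\<gamma> (Suc n) * R (Suc (Suc n)) x - \<gamma> (Suc n) * R (Suc n) x)"
    by (simp only: algebra_simps)
  also have "\<dots> = (h (Suc n) * \<alpha> (Suc n)) * (R (Suc n) x - R n x) - x * R (Suc n) x * h (Suc n)"
    unfolding R_Suc_Suc by (simp only: algebra_simps)
  also have "\<dots> = \<gamma> n * h n * (R (Suc n) x - R n x) - x * R (Suc n) x * h (Suc n)"
    by (simp only: mult.commute[of "\<gamma> n"] h_\<gamma>)
  finally show ?case
    unfolding Suc.IH by (simp only: sum.atMost_Suc algebra_simps)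
qed

lemma R_0_eq_1: "R n 0 = 1"
proof (induction n)
  case (Suc n)
  have "\<gamma> n * h n * (R (Suc n) 0 - R n 0) = 0"
    by (subst R_diff) simp
  then show ?case using \<gamma>_pos[of n] h_pos[of n] Suc by (simp del: orth_poly.simps)
qed simp

text \<open>For negative \<open>x\<close> the right-hand side of \<open>R_diff\<close> is
  nonnegative as long as all earlier values are, so \<open>R n x\<close> increases in
  \<open>n\<close> from its initial value 1.\<close>

lemma R_ge_1:
  assumes "x < 0" shows "1 \<le> R n x"
proof (induction n rule: less_induct)
  case (less n)
  show ?case
  proof (cases n)
    case (Suc m)
    have "0 \<le> (\<Sum>k\<le>m. R k x * h k)"
      using less Suc h_pos by (intro sum_nonneg mult_nonneg_nonneg) (force simp: less_Suc_eq_le less_imp_le intro: order.trans[OF zero_le_one])+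
    then have "0 \<le> \<gamma> m * h m * (R (Suc m) x - R m x)"
      using assms by (subst R_diff) (simp add: mult_nonpos_nonneg)
    moreover have "0 < \<gamma> m * h m" using \<gamma>_pos h_pos by simp
    ultimately have "R m x \<le> R (Suc m) x"
      by (simp del: orth_poly.simps add: zero_le_mult_iff)
    then show ?thesis using less[of m] Suc by (simp del: orth_poly.simps)
  qed simp
qed

section \<open>Growth of the polynomials while \<open>x / q ^ n\<close> is bounded\<close>

text \<open>Since \<open>h\<close> grows geometrically, its partial sums are comparable to their
  last term; \<open>E\<close> is the constant of this comparison.\<close>

definition "E = B * s / (b * (s - 1))"
definition "F = E / a * q / (1 - q)"

lemma E_pos: "0 < E"
  using B_ge_b b_pos s_gt_1 by (simp add: E_def)

lemma F_pos: "0 < F"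
  using E_pos a_pos q_pos q_less_1 by (simp add: F_def)

lemma sum_h_le: "(\<Sum>m\<le>n. h m) \<le> E * h n"
proof -
  have "(\<Sum>m\<le>n. h m) \<le> (\<Sum>m\<le>n. B * s ^ m)"
    by (intro sum_mono weight_le)
  also have "\<dots> = B * ((s ^ Suc n - 1) / (s - 1))"
    using s_gt_1 by (simp add: sum_distrib_left[symmetric] lessThan_Suc_atMost[symmetric]
        geometric_sum del: sum.lessThan_Suc)
  also have "\<dots> \<le> B * (s ^ Suc n / (s - 1))"
    using B_ge_b s_gt_1 by (intro mult_left_mono divide_right_mono) auto
  also have "\<dots> = E * (b * s ^ n)"
    using b_pos by (simp add: E_def)
  also have "\<dots> \<le> E * h n"
    using E_pos by (intro mult_left_mono weight_ge) auto
  finally show ?thesis .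
qed

lemma h_ratio_le:
  assumes "m \<le> n" shows "h m \<le> E * h n"
proof -
  have "h m \<le> (\<Sum>m\<le>n. h m)"
    using assms h_pos by (intro member_le_sum) (auto simp: less_imp_le)
  then show ?thesis using sum_h_le[of n] by simp
qed

text \<open>In \<open>R_diff\<close> the sum is at most \<open>Z * E * h n\<close>, so the factor
  \<open>h n\<close> cancels, and the lower bound on \<open>\<gamma> n\<close> turns
  \<open>x / \<gamma> n\<close> into the scaled variable \<open>x / q ^ n\<close>.\<close>

lemma R_diff_le:
  assumes x: "0 \<le> x" and Z: "\<And>m. m \<le> n \<Longrightarrow> \<bar>R m x\<bar> \<le> Z"
  shows "\<bar>R (Suc n) x - R n x\<bar> \<le> E / a * (x / q ^ n) * Z"
proof -
  let ?d = "\<bar>R (Suc n) x - R n x\<bar>"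
  have Z0: "0 \<le> Z" using Z[of 0] by simp
  have "\<gamma> n * h n * ?d = \<bar>\<gamma> n * h n * (R (Suc n) x - R n x)\<bar>"
    using \<gamma>_pos[of n] h_pos[of n] by (simp only: abs_mult abs_of_pos)
  also have "\<dots> = x * \<bar>\<Sum>m\<le>n. R m x * h m\<bar>"
    using x by (simp only: R_diff abs_mult) simp
  also have "\<dots> \<le> x * (\<Sum>m\<le>n. Z * h m)"
    using Z h_pos x
    by (intro mult_left_mono order.trans[OF sum_abs] sum_mono)
      (simp_all add: abs_mult less_imp_le mult_right_mono del: orth_poly.simps)
  also have "\<dots> \<le> x * (Z * (E * h n))"
    unfolding sum_distrib_left[symmetric] using Z0 x by (intro mult_left_mono sum_h_le)
  finally have "h n * (\<gamma> n * ?d) \<le> h n * (x * (Z * E))"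
    by (simp only: mult_ac)
  then have 1: "\<gamma> n * ?d \<le> x * (Z * E)"
    using h_pos[of n] by (simp only: mult_le_cancel_left_pos)
  have "a * q ^ n * ?d \<le> \<gamma> n * ?d"
    by (intro mult_right_mono \<gamma>_ge) auto
  with 1 have "a * q ^ n * ?d \<le> x * (Z * E)" by linarith
  then have "?d \<le> x * (Z * E) / (a * q ^ n)"
    using a_pos q_pos by (simp del: orth_poly.simps add: pos_le_divide_eq mult_ac)
  then show ?thesis by (simp del: orth_poly.simps add: mult_ac)
qed

lemma F_eq: "F + E / a = F / q"
  using q_pos q_less_1 a_pos by (simp add: F_def field_simps)

text \<open>The constant \<^term>\<open>F\<close> is chosen such that \<open>F + E / a = F / q\<close>, which closes the induction.\<close>
lemma R_bounds:
  assumes x: "0 \<le> x"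
  shows "\<bar>R n x\<bar> \<le> exp (F * (x / q ^ n)) \<and> \<bar>R n x - 1\<bar> \<le> F * (x / q ^ n) * exp (F * (x / q ^ n))"
proof (induction n rule: less_induct)
  case (less n)
  show ?case
  proof (cases n)
    case 0
    then show ?thesis using x F_pos by simp
  next
    case (Suc m)
    define t where "t = x / q ^ m"
    have t: "0 \<le> t" using x q_pos by (simp add: t_def)
    have n: "x / q ^ n = t / q" by (simp add: Suc t_def)
    have F: "F * t + E / a * t = F * (t / q)"
      using F_eq by (simp only: distrib_right[symmetric]) simp
    have mono: "exp (F * t) \<le> exp (F * (t / q))"
    proof -
      have "0 \<le> E / a * t" using E_pos a_pos t by simp
      then show ?thesis unfolding exp_le_cancel_iff using F by linarith
    qed
    \<comment> \<open>The scaled variable \<open>x / q ^ k\<close> increases with \<open>k\<close>,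
      so its value at \<open>m\<close> serves for all earlier indices.\<close>
    have Z: "\<bar>R k x\<bar> \<le> exp (F * t)" if "k \<le> m" for k
    proof -
      have "q ^ m \<le> q ^ k" using that q_pos q_less_1 by (intro power_decreasing) auto
      then have "x / q ^ k \<le> t"
        unfolding t_def using x q_pos by (intro divide_left_mono) auto
      then have "exp (F * (x / q ^ k)) \<le> exp (F * t)"
        unfolding exp_le_cancel_iff using F_pos by (intro mult_left_mono) auto
      then show ?thesis using less[of k] that Suc by (meson le_imp_less_Suc order.trans)
    qed
    have d: "\<bar>R (Suc m) x - R m x\<bar> \<le> E / a * t * exp (F * t)"
      unfolding t_def using R_diff_le[OF x Z[unfolded t_def]] .
    have IH: "\<bar>R m x - 1\<bar> \<le> F * t * exp (F * t)"
      using less[of m] Suc by (simp add: t_def)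
    have Et: "0 \<le> E / a * t" using E_pos a_pos t by simp
    have "\<bar>R (Suc m) x\<bar> \<le> exp (F * t) * (1 + E / a * t)"
      using d Z[OF order.refl] unfolding distrib_left mult_1_right mult.commute[of "exp (F * t)"]
      by linarith
    also have "\<dots> \<le> exp (F * t) * exp (E / a * t)"
      by (intro mult_left_mono exp_ge_add_one_self) auto
    also have "\<dots> = exp (F * (t / q))"
      by (simp only: mult_exp_exp F)
    finally have 1: "\<bar>R (Suc m) x\<bar> \<le> exp (F * (t / q))" .
    have "\<bar>R (Suc m) x - 1\<bar> \<le> F * t * exp (F * t) + E / a * t * exp (F * t)"
      using d IH by linarith
    also have "\<dots> = F * (t / q) * exp (F * t)"
      by (simp only: F[symmetric] distrib_right)
    also have "\<dots> \<le> F * (t / q) * exp (F * (t / q))"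
      using mono F_pos t q_pos by (intro mult_left_mono) auto
    finally show ?thesis using 1 unfolding n unfolding Suc by blast
  qed
qed

lemma R_le:
  assumes "0 \<le> x" "x \<le> Y * q ^ n"
  shows "\<bar>R n x\<bar> \<le> exp (F * Y)" and "\<bar>R n x - 1\<bar> \<le> F * (x / q ^ n) * exp (F * Y)"
proof -
  have "x / q ^ n \<le> Y" using assms q_pos by (simp add: pos_divide_le_eq)
  then have e: "exp (F * (x / q ^ n)) \<le> exp (F * Y)"
    unfolding exp_le_cancel_iff using F_pos by (intro mult_left_mono) auto
  then show "\<bar>R n x\<bar> \<le> exp (F * Y)" using R_bounds[OF assms(1), of n] by linarith
  have "F * (x / q ^ n) * exp (F * (x / q ^ n)) \<le> F * (x / q ^ n) * exp (F * Y)"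
    using e F_pos assms q_pos by (intro mult_left_mono) auto
  then show "\<bar>R n x - 1\<bar> \<le> F * (x / q ^ n) * exp (F * Y)"
    using R_bounds[OF assms(1), of n] by linarith
qed

section \<open>Orthogonality and open null sets\<close>

lemma has_integral_R_mult:
  "has_bochner_integral \<mu> (\<lambda>x. R n x * R m x) (if n = m then 1 / h n else 0)"
proof -
  define c where "c = sqrt (h n) * sqrt (h m)"
  have c: "c > 0" using h_pos by (simp add: c_def)
  have "has_bochner_integral \<mu>
      (\<lambda>x. orthonormal_poly \<alpha> \<gamma> n x * orthonormal_poly \<alpha> \<gamma> m x) (if n = m then 1 else 0)"
    using orth by (simp add: orthogonality_measure_def)
  then have "has_bochner_integral \<mu> (\<lambda>x. (R n x * R m x) * c) (if n = m then 1 else 0)"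
    by (simp add: orthonormal_poly_def c_def mult_ac)
  then have "has_bochner_integral \<mu> (\<lambda>x. (R n x * R m x) * c / c) ((if n = m then 1 else 0) / c)"
    by (rule has_bochner_integral_divide_zero)
  moreover have "c = h n" if "n = m"
    using h_pos[of n] that by (simp add: c_def)
  ultimately show ?thesis using c by (auto split: if_splits)
qed

lemma integrable_R_mult: "integrable \<mu> (\<lambda>x. R n x * R m x)"
  by (rule integrable.intros[OF has_integral_R_mult])

lemma integrable_R: "integrable \<mu> (R n)"
  using integrable_R_mult[of n 0] by simp

lemma integral_R_sq: "(\<integral>x. (R n x)\<^sup>2 \<partial>\<mu>) = 1 / h n"
  using has_integral_R_mult[of n n] by (simp add: has_bochner_integral_iff power2_eq_square)

text \<open>Each \<open>h n * (R n x)\<^sup>2\<close> has integral 1, so by Fatou's lemma the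
  integral of the lower limit along \<open>k\<close> is at most 1; that limit is infinite on
  \<open>U\<close>.\<close>

lemma null_if_unbounded:
  assumes "open U"
    and unb: "\<And>x. x \<in> U \<Longrightarrow> filterlim (\<lambda>j. h (k j) * (R (k j) x)\<^sup>2) at_top sequentially"
  shows "emeasure \<mu> U = 0"
proof -
  have [measurable]: "U \<in> sets \<mu>" using \<open>open U\<close> by (simp add: sets_\<mu>)
  have one: "(\<integral>\<^sup>+x. ennreal (h n * (R n x)\<^sup>2) \<partial>\<mu>) = 1" for n
  proof -
    have "integrable \<mu> (\<lambda>x. h n * (R n x)\<^sup>2)"
      using integrable_R_mult[of n n] by (simp add: power2_eq_square)
    then have "(\<integral>\<^sup>+x. ennreal (h n * (R n x)\<^sup>2) \<partial>\<mu>) = ennreal (\<integral>x. h n * (R n x)\<^sup>2 \<partial>\<mu>)"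
      using h_pos[of n] by (intro nn_integral_eq_integral) auto
    also have "(\<integral>x. h n * (R n x)\<^sup>2 \<partial>\<mu>) = 1"
      using h_pos[of n] by (simp add: integral_R_sq)
    finally show ?thesis by simp
  qed
  have "\<infinity> * emeasure \<mu> U = (\<integral>\<^sup>+x. \<infinity> * indicator U x \<partial>\<mu>)"
    by (simp add: nn_integral_cmult_indicator)
  also have "\<dots> \<le> (\<integral>\<^sup>+x. liminf (\<lambda>j. ennreal (h (k j) * (R (k j) x)\<^sup>2)) \<partial>\<mu>)"
  proof (rule nn_integral_mono)
    fix x
    show "\<infinity> * indicator U x \<le> liminf (\<lambda>j. ennreal (h (k j) * (R (k j) x)\<^sup>2))"
    proof (cases "x \<in> U")
      case True
      then have "(\<lambda>j. ennreal (h (k j) * (R (k j) x)\<^sup>2)) \<longlonglongrightarrow> top"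
        using unb by (simp only: ennreal_tendsto_top_eq_at_top)
      then have "liminf (\<lambda>j. ennreal (h (k j) * (R (k j) x)\<^sup>2)) = top"
        by (intro lim_imp_Liminf) simp_all
      then show ?thesis by simp
    qed simp
  qed
  also have "\<dots> \<le> liminf (\<lambda>j. \<integral>\<^sup>+x. ennreal (h (k j) * (R (k j) x)\<^sup>2) \<partial>\<mu>)"
    by (intro nn_integral_liminf borel_measurable_continuous_onI
        measurable_compose[OF _ measurable_ennreal] borel_measurable_times borel_measurable_power
        borel_measurable_const borel_measurable_integrable[OF integrable_R])
  also have "\<dots> = 1" by (simp add: one Liminf_const)
  finally have "\<infinity> * emeasure \<mu> U \<le> 1" .
  then show ?thesis
    by (metis ennreal_mult_eq_top_iff infinity_ennreal_def ennreal_one_neq_top neq_top_trans)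
qed

lemma geometric_at_top:
  assumes "0 < C" shows "filterlim (\<lambda>n. C * s ^ n) at_top sequentially"
proof -
  have "filterlim (\<lambda>n. s ^ n) at_infinity sequentially"
    using s_gt_1 by (intro filterlim_realpow_sequentially_gt1) simp
  then have "filterlim (\<lambda>n. s ^ n) at_top sequentially"
    using s_gt_1 by (intro filterlim_at_infinity_imp_filterlim_at_top) simp_all
  then show ?thesis
    using assms by (intro filterlim_tendsto_pos_mult_at_top[OF tendsto_const])
qed

text \<open>On the open negative half-line \<open>R n\<close> is at least 1 while \<open>h n\<close>
  tends to infinity, so this half-line is a null set.\<close>

lemma supp_nonneg:
  assumes "x \<in> supp \<mu>" shows "0 \<le> x"
proof (rule ccontr)
  assume "\<not> 0 \<le> x"
  have "emeasure \<mu> {..<0} = 0"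
  proof (rule null_if_unbounded[where k = id])
    fix y :: real assume y: "y \<in> {..<0}"
    have "filterlim (\<lambda>n. b * s ^ n) at_top sequentially"
      by (rule geometric_at_top[OF b_pos])
    moreover have "b * s ^ n \<le> h n * (R n y)\<^sup>2" for n
    proof -
      have "h n * 1 \<le> h n * (R n y)\<^sup>2"
        using R_ge_1[of y n] y h_pos[of n] by (intro mult_left_mono one_le_power) auto
      then show ?thesis using weight_ge[of n] by simp
    qed
    ultimately show "filterlim (\<lambda>j. h (id j) * (R (id j) y)\<^sup>2) at_top sequentially"
      unfolding id_def by (rule filterlim_at_top_mono[OF _ always_eventually, OF _ allI])
  qed simp
  then show False
    using assms \<open>\<not> 0 \<le> x\<close> open_lessThan[of "0::real"]
    unfolding supp_def mem_Collect_eq by (metis lessThan_iff less_irrefl not_le)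
qed

section \<open>Decay on the support once \<open>x / q ^ n\<close> is large\<close>

text \<open>Threshold for the scaled variable: \<open>s * A\<close> pays for growth by the factor
  \<open>s\<close> in one step, and \<open>5 * A\<close> dominates the remaining coefficients of the
  recurrence.\<close>

definition "X = (5 + s) * A"

lemma X_pos: "0 < X"
  using A_pos s_gt_1 by (simp add: X_def)

text \<open>By detailed balance the products \<open>h n * R n x\<close> satisfy the transposed
  recurrence, in which the off-diagonal coefficients exchange their roles.\<close>

lemma hR_rec:
  "\<alpha> (Suc (Suc n)) * (h (Suc (Suc n)) * R (Suc (Suc n)) x) =
     (\<alpha> (Suc n) + \<gamma> (Suc n) - x) * (h (Suc n) * R (Suc n) x) - \<gamma> n * (h n * R n x)"
proof -
  have "\<alpha> (Suc (Suc n)) * (h (Suc (Suc n)) * R (Suc (Suc n)) x)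
      = h (Suc n) * (\<gamma> (Suc n) * R (Suc (Suc n)) x)"
    using h_\<gamma>[of "Suc n"] by (metis mult.assoc mult.commute)
  also have "\<dots> = (\<alpha> (Suc n) + \<gamma> (Suc n) - x) * (h (Suc n) * R (Suc n) x)
      - (h (Suc n) * \<alpha> (Suc n)) * R n x"
    unfolding R_Suc_Suc by (simp only: algebra_simps)
  finally show ?thesis by (simp only: h_\<gamma>[symmetric] mult.commute[of "h n" "\<gamma> n"] mult.assoc)
qed

text \<open>Beyond the scale \<open>X * q ^ m < x\<close> the recurrence is hyperbolic: a solution that fails to
  decay once grows from then on.\<close>
lemma hR_growth_step:
  assumes x: "X * q ^ m < x"
    and no_decay: "\<bar>h m * R m x\<bar> < 2 * \<bar>h (Suc m) * R (Suc m) x\<bar>"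
  shows "s * \<bar>h (Suc m) * R (Suc m) x\<bar> \<le> \<bar>h (Suc (Suc m)) * R (Suc (Suc m)) x\<bar>"
proof -
  define u where "u n = h n * R n x" for n
  let ?\<alpha>1 = "\<alpha> (Suc m)" and ?\<alpha>2 = "\<alpha> (Suc (Suc m))"
  have A_Suc: "A * q ^ Suc n \<le> A * q ^ n" for n
    using A_pos q_pos q_less_1 by (intro mult_left_mono power_decreasing) auto
  have b1: "?\<alpha>1 \<le> A * q ^ m" and b2: "\<gamma> (Suc m) \<le> A * q ^ m" and b3: "\<gamma> m \<le> A * q ^ m"
    and b4: "?\<alpha>2 \<le> A * q ^ m"
    using \<alpha>_le[of "Suc m"] \<gamma>_le[of "Suc m"] \<gamma>_le[of m] \<alpha>_le[of "Suc (Suc m)"]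
      A_Suc[of m] A_Suc[of "Suc m"] by linarith+
  have "s * ?\<alpha>2 \<le> s * (A * q ^ m)"
    using b4 s_gt_1 by (intro mult_left_mono) auto
  moreover have "X * q ^ m = 5 * (A * q ^ m) + s * (A * q ^ m)"
    by (simp add: X_def algebra_simps)
  moreover have "0 < A * q ^ m" using A_pos q_pos by simp
  \<comment> \<open>The factor 2 at \<open>\<gamma> m\<close> comes from \<open>no_decay\<close>,
    which bounds the older term of the recurrence by twice the newer one.\<close>
  ultimately have big: "s * ?\<alpha>2 \<le> x - (?\<alpha>1 + \<gamma> (Suc m)) - 2 * \<gamma> m"
    using b1 b2 b3 x by linarith
  have "?\<alpha>2 * (s * \<bar>u (Suc m)\<bar>) \<le> (x - (?\<alpha>1 + \<gamma> (Suc m)) - 2 * \<gamma> m) * \<bar>u (Suc m)\<bar>"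
    using mult_right_mono[OF big, of "\<bar>u (Suc m)\<bar>"] by (simp add: mult_ac)
  also have "\<dots> \<le> (x - (?\<alpha>1 + \<gamma> (Suc m))) * \<bar>u (Suc m)\<bar> - \<gamma> m * \<bar>u m\<bar>"
  proof -
    have "\<gamma> m * \<bar>u m\<bar> \<le> \<gamma> m * (2 * \<bar>u (Suc m)\<bar>)"
      using no_decay \<gamma>_pos[of m] unfolding u_def by (intro mult_left_mono) auto
    then show ?thesis by (simp add: algebra_simps)
  qed
  also have "\<dots> = \<bar>(?\<alpha>1 + \<gamma> (Suc m) - x) * u (Suc m)\<bar> - \<bar>\<gamma> m * u m\<bar>"
  proof -
    have "0 \<le> s * ?\<alpha>2" using s_gt_1 \<alpha>_pos[of "Suc m"] by simp
    then have "?\<alpha>1 + \<gamma> (Suc m) - x \<le> 0" using big \<gamma>_pos[of m] by linarith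
    then show ?thesis using \<gamma>_pos[of m] by (simp add: abs_mult)
  qed
  also have "\<dots> \<le> \<bar>?\<alpha>2 * u (Suc (Suc m))\<bar>"
    unfolding u_def hR_rec by linarith
  also have "\<dots> = ?\<alpha>2 * \<bar>u (Suc (Suc m))\<bar>"
    using \<alpha>_pos[of "Suc m"] by (simp add: abs_mult)
  finally show ?thesis
    using \<alpha>_pos[of "Suc m"] unfolding u_def by (simp only: mult_le_cancel_left_pos)
qed

text \<open>Both claims are carried through one induction: growth by the factor \<open>s > 1\<close>
  of a nonzero value implies failure of decay at the next index, which again permits a growth
  step.\<close>

lemma hR_growth:
  assumes x: "X * q ^ m < x"
    and no_decay: "\<bar>h m * R m x\<bar> < 2 * \<bar>h (Suc m) * R (Suc m) x\<bar>"
  shows "s ^ j * \<bar>h (Suc m) * R (Suc m) x\<bar> \<le> \<bar>h (Suc m + j) * R (Suc m + j) x\<bar>"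
    and "\<bar>h (m + j) * R (m + j) x\<bar> < 2 * \<bar>h (Suc m + j) * R (Suc m + j) x\<bar>"
proof (induction j)
  case 0
  case 1 show ?case by simp
  case 2 show ?case using no_decay by simp
next
  case (Suc j)
  have "X * q ^ (m + j) \<le> X * q ^ m"
    using X_pos q_pos q_less_1 by (intro mult_left_mono power_decreasing) auto
  then have step: "s * \<bar>h (Suc m + j) * R (Suc m + j) x\<bar>
      \<le> \<bar>h (Suc m + Suc j) * R (Suc m + Suc j) x\<bar>"
    using hR_growth_step[of "m + j" x] x Suc.IH(2) by (simp del: orth_poly.simps)
  case 1
  have "s ^ Suc j * \<bar>h (Suc m) * R (Suc m) x\<bar> \<le> s * \<bar>h (Suc m + j) * R (Suc m + j) x\<bar>"
    using Suc.IH(1) s_gt_1 by (simp only: power_Suc mult.assoc) simp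
  then show ?case using step by linarith
  case 2
  have "1 * \<bar>h (Suc m + j) * R (Suc m + j) x\<bar> \<le> s * \<bar>h (Suc m + j) * R (Suc m + j) x\<bar>"
    using s_gt_1 by (intro mult_right_mono) auto
  moreover have "0 < \<bar>h (Suc m + j) * R (Suc m + j) x\<bar>"
    using Suc.IH(2) by linarith
  ultimately show ?case using step
    by (simp only: add_Suc add_Suc_right mult_1_left)
qed

text \<open>If decay fails at \<open>x\<close>, it fails on an open neighbourhood of
  \<open>x\<close>, where \<open>hR_growth\<close> makes \<open>h n * (R n y)\<^sup>2\<close>
  unbounded. Such a neighbourhood is null, which contradicts membership in the support.\<close>

lemma hR_decay:
  assumes x: "x \<in> supp \<mu>" "X * q ^ m < x"
  shows "2 * \<bar>h (Suc m) * R (Suc m) x\<bar> \<le> \<bar>h m * R m x\<bar>"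
proof (rule ccontr)
  assume *: "\<not> ?thesis"
  define U where "U = {y. X * q ^ m < y \<and> \<bar>h m * R m y\<bar> < 2 * \<bar>h (Suc m) * R (Suc m) y\<bar>}"
  have "open U"
    unfolding U_def by (intro open_Collect_conj open_Collect_less continuous_intros)
  moreover have "emeasure \<mu> U = 0"
  proof (rule null_if_unbounded[OF \<open>open U\<close>, where k = "\<lambda>j. Suc m + j"])
    fix y assume "y \<in> U"
    then have y: "X * q ^ m < y" "\<bar>h m * R m y\<bar> < 2 * \<bar>h (Suc m) * R (Suc m) y\<bar>"
      by (auto simp: U_def)
    define d where "d = \<bar>h (Suc m) * R (Suc m) y\<bar>"
    have d: "0 < d" using y(2) unfolding d_def by linarith
    \<comment> \<open>The square of \<open>h n * R n y\<close> grows at least like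
      \<open>s ^ (2 * j)\<close>; division by \<open>h n\<close>, which is at most of order
      \<open>s ^ j\<close>, leaves one factor \<open>s ^ j\<close>.\<close>
    have "d\<^sup>2 / (B * s ^ Suc m) * s ^ j \<le> h (Suc m + j) * (R (Suc m + j) y)\<^sup>2" for j
    proof -
      let ?n = "Suc m + j"
      have "(s ^ j * d)\<^sup>2 \<le> (h ?n * R ?n y)\<^sup>2"
        using power_mono[OF hR_growth(1)[OF y, of j, folded d_def], of 2] s_gt_1 d by simp
      also have "\<dots> = h ?n * (h ?n * (R ?n y)\<^sup>2)"
        by (simp only: power2_eq_square mult_ac)
      also have "\<dots> \<le> (B * s ^ ?n) * (h ?n * (R ?n y)\<^sup>2)"
        using h_pos[of ?n] by (intro mult_right_mono weight_le) auto
      finally have "s ^ j * (s ^ j * d\<^sup>2) \<le> s ^ j * (B * s ^ Suc m * (h ?n * (R ?n y)\<^sup>2))"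
        by (simp del: orth_poly.simps add: power2_eq_square power_add mult_ac)
      then have "s ^ j * d\<^sup>2 \<le> B * s ^ Suc m * (h ?n * (R ?n y)\<^sup>2)"
        using s_gt_1 by (subst (asm) mult_le_cancel_left_pos) auto
      moreover have "0 < B * s ^ Suc m" using B_ge_b s_gt_1 by simp
      ultimately show ?thesis
        by (simp del: orth_poly.simps power_Suc add: pos_divide_le_eq mult_ac)
    qed
    moreover have "0 < d\<^sup>2 / (B * s ^ Suc m)" using d B_ge_b s_gt_1 by simp
    then have "filterlim (\<lambda>j. d\<^sup>2 / (B * s ^ Suc m) * s ^ j) at_top sequentially"
      by (rule geometric_at_top)
    ultimately show "filterlim (\<lambda>j. h (Suc m + j) * (R (Suc m + j) y)\<^sup>2) at_top sequentially"
      by (rule filterlim_at_top_mono[OF _ always_eventually, OF _ allI, rotated])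
  qed
  moreover have "x \<in> U"
    using x(2) * unfolding U_def by (simp only: not_le mem_Collect_eq)
  ultimately show False
    using x(1) \<open>open U\<close> unfolding supp_def mem_Collect_eq by (metis less_irrefl)
qed

text \<open>For \<open>x > X\<close> the decay already holds from index 0 to 1. With the explicit
  first polynomial it places \<open>x\<close> within \<open>\<alpha> 1 / 2\<close> of
  \<open>\<gamma> 0\<close>, which is impossible for \<open>x > 5 * A\<close>.\<close>

lemma supp_le_X:
  assumes "x \<in> supp \<mu>" shows "x \<le> X"
proof (rule ccontr)
  assume *: "\<not> x \<le> X"
  then have "2 * \<bar>h (Suc 0) * R (Suc 0) x\<bar> \<le> 1"
    using hR_decay[of x 0] assms by simp
  moreover have "h (Suc 0) * R (Suc 0) x = (\<gamma> 0 - x) / \<alpha> (Suc 0)"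
    using R_1[of x] by (simp only: weight_Suc weight_0 mult_1_left times_divide_eq_left)
  ultimately have "2 * \<bar>\<gamma> 0 - x\<bar> \<le> \<alpha> (Suc 0)"
    using \<alpha>_pos[of 0] by (simp add: abs_divide pos_divide_le_eq)
  moreover have "\<gamma> 0 \<le> A" "\<alpha> (Suc 0) \<le> A"
    using \<gamma>_le[of 0] \<alpha>_le[of 1] A_pos q_less_1 by (auto intro: order.trans simp: mult_left_le)
  ultimately show False
  proof -
    assume "2 * \<bar>\<gamma> 0 - x\<bar> \<le> \<alpha> (Suc 0)" "\<gamma> 0 \<le> A" "\<alpha> (Suc 0) \<le> A"
    moreover have "5 * A < x"
    proof -
      have "0 < s * A" using A_pos s_gt_1 by simp
      then show ?thesis using * by (simp add: X_def distrib_right)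
    qed
    moreover have "x - \<gamma> 0 \<le> \<bar>\<gamma> 0 - x\<bar>" by simp
    ultimately show False using A_pos by argo
  qed
qed

lemma compact_supp: "compact (supp \<mu>)"
proof -
  have "supp \<mu> \<subseteq> {0..X}" using supp_nonneg supp_le_X by auto
  then show ?thesis
    using supp_complement_null(2)[OF sets_\<mu>] bounded_subset[OF bounded_closed_interval]
    by (simp add: compact_eq_bounded_closed)
qed

lemma AE_supp: "AE x in \<mu>. x \<in> supp \<mu>"
  using AE_not_in[OF supp_complement_null(1)[OF sets_\<mu>]] by (simp only: Compl_iff not_not)

text \<open>The halving of \<open>h n * R n x\<close> is iterated; the quotient of the weights is
  then absorbed into \<open>E\<close>.\<close>

lemma R_decay:
  assumes x: "x \<in> supp \<mu>" "X * q ^ k < x" and n: "k \<le> n"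
  shows "\<bar>R n x\<bar> \<le> E * \<bar>R k x\<bar> * (1 / 2) ^ (n - k)"
proof -
  have "\<bar>h (k + j) * R (k + j) x\<bar> \<le> \<bar>h k * R k x\<bar> * (1 / 2) ^ j" for j
  proof (induction j)
    case (Suc j)
    have "X * q ^ (k + j) \<le> X * q ^ k"
      using X_pos q_pos q_less_1 by (intro mult_left_mono power_decreasing) auto
    then have "2 * \<bar>h (Suc (k + j)) * R (Suc (k + j)) x\<bar> \<le> \<bar>h (k + j) * R (k + j) x\<bar>"
      using x by (intro hR_decay) auto
    then show ?case using Suc by (simp del: orth_poly.simps)
  qed simp
  from this[of "n - k"] have "h n * \<bar>R n x\<bar> \<le> h k * (\<bar>R k x\<bar> * (1 / 2) ^ (n - k))"
    using n h_pos[of n] h_pos[of k]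
    by (simp only: abs_mult abs_of_pos mult.assoc le_add_diff_inverse)
  also have "\<dots> \<le> E * h n * (\<bar>R k x\<bar> * (1 / 2) ^ (n - k))"
    by (intro mult_right_mono h_ratio_le[OF n]) simp
  also have "\<dots> = h n * (E * \<bar>R k x\<bar> * (1 / 2) ^ (n - k))" by simp
  finally show ?thesis using h_pos[of n] by simp
qed

section \<open>Mass near zero and integrals of the polynomials\<close>

text \<open>Where \<open>R n\<close> is at least 1/2, its squared norm \<open>1 / h n\<close>
  controls the mass. This holds on a short interval of length proportional to \<open>q ^ n\<close>;
  a fixed shift of the index passes to the longer interval with threshold \<open>X\<close>.\<close>

lemma interval_measure_bound:
  "\<exists>C. \<forall>n. h n * measure \<mu> {0..X * q ^ n} \<le> C"
proof -
  \<comment> \<open>Chosen so that \<open>F * \<epsilon> * exp F \<le> 1 / 2\<close>; the bound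
    \<open>\<epsilon> \<le> 1\<close> allows \<open>exp (F * \<epsilon>)\<close> to be replaced by
    \<open>exp F\<close>.\<close>
  define \<epsilon> where "\<epsilon> = min 1 (1 / (2 * F * exp F))"
  have \<epsilon>: "0 < \<epsilon>" "\<epsilon> \<le> 1" "\<epsilon> \<le> 1 / (2 * F * exp F)" using F_pos by (auto simp: \<epsilon>_def)
  have near: "h n * measure \<mu> {0..\<epsilon> * q ^ n} \<le> 4" for n
  proof -
    have "1 / 4 * indicator {0..\<epsilon> * q ^ n} x \<le> (R n x)\<^sup>2" for x :: real
    proof (cases "x \<in> {0..\<epsilon> * q ^ n}")
      case True
      then have x: "0 \<le> x" "x \<le> \<epsilon> * q ^ n" by auto
      have "x / q ^ n \<le> \<epsilon>" using x q_pos by (simp add: pos_divide_le_eq)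
      then have "F * (x / q ^ n) * exp (F * \<epsilon>) \<le> F * \<epsilon> * exp F"
        using F_pos \<epsilon> x q_pos by (intro mult_mono mult_left_mono) auto
      also have "\<dots> \<le> 1 / 2"
        using \<epsilon>(3) F_pos by (simp add: pos_le_divide_eq mult_ac)
      finally have "\<bar>R n x - 1\<bar> \<le> 1 / 2"
        using R_le(2)[OF x] by linarith
      then have "1 / 2 \<le> R n x" by linarith
      then have "(1 / 2)\<^sup>2 \<le> (R n x)\<^sup>2" by (intro power_mono) auto
      then show ?thesis using True by (simp add: power2_eq_square)
    qed simp
    then have "(\<integral>x. 1 / 4 * indicator {0..\<epsilon> * q ^ n} x \<partial>\<mu>) \<le> (\<integral>x. (R n x)\<^sup>2 \<partial>\<mu>)"
      using integrable_R_mult[of n n]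
      by (intro integral_mono) (auto simp: sets_\<mu> power2_eq_square less_top[symmetric])
    then show ?thesis
      using h_pos[of n] by (simp add: integral_R_sq sets_\<mu> pos_le_divide_eq mult_ac)
  qed
  \<comment> \<open>With this shift the interval of index \<open>m + j\<close> and threshold
    \<open>X\<close> lies in the one of index \<open>m\<close> and threshold
    \<open>\<epsilon>\<close>.\<close>
  obtain j where "q ^ j < \<epsilon> / X"
    using real_arch_pow_inv[of "\<epsilon> / X" q] \<epsilon> X_pos q_less_1 by auto
  then have j: "X * q ^ j \<le> \<epsilon>" using X_pos by (simp add: pos_less_divide_eq mult_ac)
  \<comment> \<open>The first entry covers the indices up to \<open>j\<close>, where the mass is
    bounded by 1; in the second, \<open>B * s ^ j / b\<close> bounds the change of \<open>h\<close>
    under the shift.\<close>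
  define C where "C = max (B * s ^ j) (4 * (B * s ^ j / b))"
  have "h n * measure \<mu> {0..X * q ^ n} \<le> C" for n
  proof (cases "n \<le> j")
    case True
    have "h n * measure \<mu> {0..X * q ^ n} \<le> h n * 1"
      using h_pos[of n] by (intro mult_left_mono) auto
    also have "\<dots> \<le> B * s ^ j"
      using weight_le[of n] mult_left_mono[OF power_increasing[OF True, of s], of B] s_gt_1 B_ge_b
      by linarith
    finally show ?thesis by (simp add: C_def)
  next
    case False
    define m where "m = n - j"
    have n: "n = m + j" using False by (simp add: m_def)
    have "X * q ^ n \<le> \<epsilon> * q ^ m"
      using mult_right_mono[OF j, of "q ^ m"] q_pos by (simp add: n power_add mult_ac)
    then have "measure \<mu> {0..X * q ^ n} \<le> measure \<mu> {0..\<epsilon> * q ^ m}"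
      by (intro finite_measure_mono) (auto simp: sets_\<mu>)
    moreover have "h n \<le> (B * s ^ j / b) * h m"
    proof -
      have "h n \<le> (B * s ^ j / b) * (b * s ^ m)"
        using weight_le[of n] b_pos by (simp add: n power_add mult_ac)
      also have "\<dots> \<le> (B * s ^ j / b) * h m"
        using B_ge_b b_pos s_gt_1 by (intro mult_left_mono weight_ge) auto
      finally show ?thesis .
    qed
    ultimately have "h n * measure \<mu> {0..X * q ^ n} \<le> (B * s ^ j / b) * h m * measure \<mu> {0..\<epsilon> * q ^ m}"
      using h_pos[of m] B_ge_b b_pos s_gt_1 by (intro mult_mono) auto
    also have "\<dots> \<le> (B * s ^ j / b) * 4"
      unfolding mult.assoc using near[of m] B_ge_b b_pos s_gt_1 by (intro mult_left_mono) auto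
    finally show ?thesis by (simp only: C_def mult.commute[of 4] max.coboundedI2)
  qed
  then show ?thesis by blast
qed

lemma integrable_ind: "integrable \<mu> (indicator {0..y} :: real \<Rightarrow> real)"
  by (auto simp: sets_\<mu> less_top[symmetric])

text \<open>Almost every point lies in the support, where either \<open>x \<le> X * q ^ n\<close>
  and the exponential bound applies on a set of mass of order \<open>1 / h n\<close>, or
  \<open>hR_decay\<close> halves the previous integrand. The integrals thus satisfy an affine
  recursion with factor 1/2.\<close>

lemma integral_abs_R_bound:
  "\<exists>C>0. \<forall>n. h n * (\<integral>x. \<bar>R n x\<bar> \<partial>\<mu>) \<le> C"
proof -
  obtain M where M: "\<And>n. h n * measure \<mu> {0..X * q ^ n} \<le> M"
    using interval_measure_bound by blast
  define H where "H n = h n * (\<integral>x. \<bar>R n x\<bar> \<partial>\<mu>)" for n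
  define c where "c = B * s / b"
  have c: "0 \<le> c" using B_ge_b b_pos s_gt_1 by (simp add: c_def)
  have M0: "0 \<le> M"
    using M[of 0] h_pos[of 0]
    by (meson less_imp_le measure_nonneg mult_nonneg_nonneg order.trans)
  define D where "D = c * exp (F * (X / q)) * M"
  have D: "0 \<le> D" using c M0 by (simp add: D_def)
  have step: "H (Suc n) \<le> D + 1 / 2 * H n" for n
  proof -
    let ?I = "indicator {0..X * q ^ n} :: real \<Rightarrow> real"
    have "AE x in \<mu>. h (Suc n) * \<bar>R (Suc n) x\<bar>
        \<le> h (Suc n) * exp (F * (X / q)) * ?I x + 1 / 2 * (h n * \<bar>R n x\<bar>)"
      using AE_supp
    proof eventually_elim
      fix x assume x: "x \<in> supp \<mu>"
      show "h (Suc n) * \<bar>R (Suc n) x\<bar>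
        \<le> h (Suc n) * exp (F * (X / q)) * ?I x + 1 / 2 * (h n * \<bar>R n x\<bar>)"
      proof (cases "x \<le> X * q ^ n")
        case True
        have "X * q ^ n = X / q * q ^ Suc n" using q_pos by simp
        then have "\<bar>R (Suc n) x\<bar> \<le> exp (F * (X / q))"
          using R_le(1)[of x "X / q" "Suc n"] supp_nonneg[OF x] True by simp
        then have "h (Suc n) * \<bar>R (Suc n) x\<bar> \<le> h (Suc n) * exp (F * (X / q))"
          using h_pos[of "Suc n"] by (intro mult_left_mono) auto
        moreover have "0 \<le> 1 / 2 * (h n * \<bar>R n x\<bar>)" using h_pos[of n] by simp
        ultimately show ?thesis using True supp_nonneg[OF x] by (simp del: orth_poly.simps)
      next
        case False
        then show ?thesis
          using hR_decay[OF x, of n] h_pos[of n] h_pos[of "Suc n"]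
          by (simp del: orth_poly.simps add: abs_mult)
      qed
    qed
    then have "(\<integral>x. h (Suc n) * \<bar>R (Suc n) x\<bar> \<partial>\<mu>)
        \<le> (\<integral>x. h (Suc n) * exp (F * (X / q)) * ?I x + 1 / 2 * (h n * \<bar>R n x\<bar>) \<partial>\<mu>)"
      by (intro integral_mono_AE Bochner_Integration.integrable_add
          integrable_mult_right integrable_abs integrable_R integrable_ind)
    also have "\<dots> = h (Suc n) * exp (F * (X / q)) * measure \<mu> {0..X * q ^ n} + 1 / 2 * H n"
      using integrable_ind[of "X * q ^ n"] integrable_R[of n]
      by (subst Bochner_Integration.integral_add) (auto simp: H_def sets_\<mu>)
    also have "h (Suc n) * exp (F * (X / q)) * measure \<mu> {0..X * q ^ n} \<le> D"
    proof -
      have "h (Suc n) \<le> c * h n"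
      proof -
        have "h (Suc n) \<le> c * (b * s ^ n)"
          using weight_le[of "Suc n"] b_pos by (simp add: c_def mult_ac)
        also have "\<dots> \<le> c * h n"
          using c by (intro mult_left_mono weight_ge)
        finally show ?thesis .
      qed
      then have "h (Suc n) * exp (F * (X / q)) * measure \<mu> {0..X * q ^ n}
          \<le> c * h n * exp (F * (X / q)) * measure \<mu> {0..X * q ^ n}"
        by (intro mult_right_mono) auto
      also have "\<dots> = c * exp (F * (X / q)) * (h n * measure \<mu> {0..X * q ^ n})"
        by simp
      also have "\<dots> \<le> D"
        unfolding D_def using c by (intro mult_left_mono M) auto
      finally show ?thesis .
    qed
    finally show ?thesis by (simp add: H_def)
  qed
  \<comment> \<open>The value \<open>2 * D\<close> is the fixed point of the recursion, and 1 is the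
    initial value \<open>H 0\<close>.\<close>
  have "H n \<le> max 1 (2 * D)" for n
  proof (induction n)
    case 0
    then show ?case by (simp add: H_def prob_space)
  next
    case (Suc n)
    then show ?case using step[of n] by linarith
  qed
  then show ?thesis unfolding H_def by (intro exI[of _ "max 1 (2 * D)"]) auto
qed

section \<open>Boundedness of the Lebesgue constants\<close>

text \<open>The Christoffel-Darboux kernel of the partial sums; the integral of its absolute value
  in \<open>y\<close> is the Lebesgue function at \<open>x\<close>.\<close>

definition "K n x y = (\<Sum>m\<le>n. R m x * R m y * h m)"

lemma integrable_K: "integrable \<mu> (K n x)"
  unfolding K_def by (intro Bochner_Integration.integrable_sum integrable_mult_left
      integrable_mult_right integrable_R)

text \<open>For \<open>y \<le> X * q ^ n\<close> all terms of the kernel are bounded by multiples of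
  the weights, and the mass estimate applies. For larger \<open>y\<close> the telescoped form
  \<open>R_diff\<close> expresses the kernel through \<open>R n\<close> and
  \<open>R (Suc n)\<close>.\<close>

lemma K_0_bound: "\<exists>C. \<forall>n. (\<integral>y. \<bar>K n 0 y\<bar> \<partial>\<mu>) \<le> C"
proof -
  obtain M where M: "\<And>n. h n * measure \<mu> {0..X * q ^ n} \<le> M"
    using interval_measure_bound by blast
  obtain H where H: "\<And>n. h n * (\<integral>x. \<bar>R n x\<bar> \<partial>\<mu>) \<le> H" "0 < H"
    using integral_abs_R_bound by blast
  have K0: "K n 0 y = (\<Sum>m\<le>n. R m y * h m)" for n y
    by (simp only: K_def R_0_eq_1 mult_1_left)
  define C1 where "C1 = exp (F * X) * E"
  define C2 where "C2 = A / X"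
  have C1: "0 < C1" and C2: "0 < C2" using E_pos A_pos X_pos by (auto simp: C1_def C2_def)
  have "(\<integral>y. \<bar>K n 0 y\<bar> \<partial>\<mu>) \<le> C1 * M + C2 * (E * H + H)" for n
  proof -
    let ?I = "indicator {0..X * q ^ n} :: real \<Rightarrow> real"
    have "AE y in \<mu>. \<bar>K n 0 y\<bar> \<le> C1 * h n * ?I y + C2 * h n * (\<bar>R (Suc n) y\<bar> + \<bar>R n y\<bar>)"
      using AE_supp
    proof eventually_elim
      fix y assume y: "y \<in> supp \<mu>"
      show "\<bar>K n 0 y\<bar> \<le> C1 * h n * ?I y + C2 * h n * (\<bar>R (Suc n) y\<bar> + \<bar>R n y\<bar>)"
      proof (cases "y \<le> X * q ^ n")
        case True
        have R: "\<bar>R m y\<bar> \<le> exp (F * X)" if "m \<le> n" for m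
        proof (rule R_le(1)[OF supp_nonneg[OF y]])
          have "X * q ^ n \<le> X * q ^ m"
            using that X_pos q_pos q_less_1 by (intro mult_left_mono power_decreasing) auto
          then show "y \<le> X * q ^ m" using True by linarith
        qed
        have "\<bar>K n 0 y\<bar> \<le> (\<Sum>m\<le>n. exp (F * X) * h m)"
          unfolding K0 using R h_pos
          by (intro order.trans[OF sum_abs] sum_mono)
            (auto simp: abs_mult less_imp_le intro!: mult_mono)
        also have "\<dots> \<le> C1 * h n"
          unfolding C1_def sum_distrib_left[symmetric] mult.assoc
          by (intro mult_left_mono sum_h_le) auto
        finally have "\<bar>K n 0 y\<bar> \<le> C1 * h n * ?I y"
          using True supp_nonneg[OF y] by simp
        moreover have "0 \<le> C2 * h n * (\<bar>R (Suc n) y\<bar> + \<bar>R n y\<bar>)"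
          using C2 h_pos[of n] by (simp del: orth_poly.simps)
        ultimately show ?thesis by linarith
      next
        case False
        then have yX: "X * q ^ n \<le> y" by simp
        have Xq: "0 < X * q ^ n" using X_pos q_pos by simp
        \<comment> \<open>The factor \<open>y\<close> in \<open>R_diff\<close> is at least
          \<open>X * q ^ n\<close> and compensates \<open>\<gamma> n \<le> A * q ^ n\<close>; the
          quotient is \<open>C2 = A / X\<close>.\<close>
        have "X * q ^ n * \<bar>K n 0 y\<bar> \<le> y * \<bar>K n 0 y\<bar>"
          using yX by (intro mult_right_mono) auto
        also have "\<dots> = \<bar>- y * K n 0 y\<bar>"
          using yX Xq by (simp add: abs_mult)
        also have "\<dots> = \<bar>\<gamma> n * h n * (R (Suc n) y - R n y)\<bar>"
          unfolding K0 R_diff ..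
        also have "\<dots> = \<gamma> n * (h n * \<bar>R (Suc n) y - R n y\<bar>)"
          using h_pos[of n] \<gamma>_pos[of n] by (simp only: abs_mult abs_of_pos mult.assoc)
        also have "\<dots> \<le> A * q ^ n * (h n * (\<bar>R (Suc n) y\<bar> + \<bar>R n y\<bar>))"
          using A_pos q_pos h_pos[of n] by (intro mult_mono \<gamma>_le abs_triangle_ineq4) auto
        also have "\<dots> = X * q ^ n * (C2 * h n * (\<bar>R (Suc n) y\<bar> + \<bar>R n y\<bar>))"
          using X_pos by (simp del: orth_poly.simps add: C2_def)
        finally have "\<bar>K n 0 y\<bar> \<le> C2 * h n * (\<bar>R (Suc n) y\<bar> + \<bar>R n y\<bar>)"
          using Xq by (simp only: mult_le_cancel_left_pos)
        then show ?thesis using False by (simp del: orth_poly.simps)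
      qed
    qed
    then have "(\<integral>y. \<bar>K n 0 y\<bar> \<partial>\<mu>)
        \<le> (\<integral>y. C1 * h n * ?I y + C2 * h n * (\<bar>R (Suc n) y\<bar> + \<bar>R n y\<bar>) \<partial>\<mu>)"
      by (intro integral_mono_AE Bochner_Integration.integrable_add integrable_K
          integrable_mult_right integrable_abs integrable_R integrable_ind)
    also have "\<dots> = C1 * h n * measure \<mu> {0..X * q ^ n}
        + C2 * h n * ((\<integral>y. \<bar>R (Suc n) y\<bar> \<partial>\<mu>) + (\<integral>y. \<bar>R n y\<bar> \<partial>\<mu>))"
      using integrable_ind[of "X * q ^ n"] integrable_abs[OF integrable_R[of n]]
        integrable_abs[OF integrable_R[of "Suc n"]]
      by (subst Bochner_Integration.integral_add)
        (simp_all add: sets_\<mu> Bochner_Integration.integral_add del: orth_poly.simps)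
    also have "\<dots> = C1 * (h n * measure \<mu> {0..X * q ^ n})
        + C2 * (h n * (\<integral>y. \<bar>R (Suc n) y\<bar> \<partial>\<mu>) + h n * (\<integral>y. \<bar>R n y\<bar> \<partial>\<mu>))"
      by (simp only: mult.assoc distrib_left)
    also have "\<dots> \<le> C1 * M + C2 * (E * H + H)"
    proof -
      \<comment> \<open>The weight has index \<open>n\<close> while the polynomial has index
        \<open>Suc n\<close>; the mismatch costs the factor \<open>E\<close>.\<close>
      have "h n * (\<integral>y. \<bar>R (Suc n) y\<bar> \<partial>\<mu>) \<le> E * h (Suc n) * (\<integral>y. \<bar>R (Suc n) y\<bar> \<partial>\<mu>)"
        by (intro mult_right_mono h_ratio_le) auto
      also have "\<dots> \<le> E * H"
        unfolding mult.assoc using E_pos by (intro mult_left_mono H) auto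
      finally show ?thesis
        using C1 C2 by (intro add_mono mult_left_mono M H) auto
    qed
    finally show ?thesis .
  qed
  then show ?thesis by blast
qed

text \<open>Integrates a pointwise comparison of two kernels. It serves both regimes: comparison
  with the point 0 at the same \<open>n\<close>, and with a shorter sum at the same point.\<close>

lemma integral_K_le:
  assumes H: "\<And>n. h n * (\<integral>x. \<bar>R n x\<bar> \<partial>\<mu>) \<le> H" and w: "\<And>m. m \<in> M \<Longrightarrow> 0 \<le> w m"
    and le: "\<And>y. \<bar>K n x y\<bar> \<le> \<bar>K k z y\<bar> + (\<Sum>m\<in>M. w m * (h m * \<bar>R m y\<bar>))"
  shows "(\<integral>y. \<bar>K n x y\<bar> \<partial>\<mu>) \<le> (\<integral>y. \<bar>K k z y\<bar> \<partial>\<mu>) + (\<Sum>m\<in>M. w m * H)"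
proof -
  have int: "integrable \<mu> (\<lambda>y. w m * (h m * \<bar>R m y\<bar>))" for m
    using integrable_R[of m] by simp
  have intK: "integrable \<mu> (\<lambda>y. \<bar>K n x y\<bar>)" for n x
    using integrable_K[of n x] by simp
  have "(\<integral>y. \<bar>K n x y\<bar> \<partial>\<mu>) \<le> (\<integral>y. \<bar>K k z y\<bar> + (\<Sum>m\<in>M. w m * (h m * \<bar>R m y\<bar>)) \<partial>\<mu>)"
    using le by (intro integral_mono[OF intK Bochner_Integration.integrable_add[OF intK
        Bochner_Integration.integrable_sum[OF int]]])
  also have "\<dots> = (\<integral>y. \<bar>K k z y\<bar> \<partial>\<mu>) + (\<Sum>m\<in>M. \<integral>y. w m * (h m * \<bar>R m y\<bar>) \<partial>\<mu>)"
    by (simp only: Bochner_Integration.integral_add[OF intK Bochner_Integration.integrable_sum[OF int]]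
        Bochner_Integration.integral_sum[OF int])
  also have "\<dots> \<le> (\<integral>y. \<bar>K k z y\<bar> \<partial>\<mu>) + (\<Sum>m\<in>M. w m * H)"
    using H w by (intro add_left_mono sum_mono) (simp add: mult_left_mono)
  finally show ?thesis .
qed

text \<open>The difference from the kernel at 0 has coefficients \<open>R m x - 1\<close> of order
  \<open>x / q ^ m\<close>. Their sum over \<open>m \<le> n\<close> is geometric and dominated by
  its last term, which is at most of order \<open>X\<close>.\<close>

lemma Lebesgue_constant_small_bound:
  "\<exists>C. \<forall>n. \<forall>x. 0 \<le> x \<and> x \<le> X * q ^ n \<longrightarrow> (\<integral>y. \<bar>K n x y\<bar> \<partial>\<mu>) \<le> C"
proof -
  obtain C0 where C0: "\<And>n. (\<integral>y. \<bar>K n 0 y\<bar> \<partial>\<mu>) \<le> C0"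
    using K_0_bound by blast
  obtain H where H: "\<And>n. h n * (\<integral>x. \<bar>R n x\<bar> \<partial>\<mu>) \<le> H" "0 < H"
    using integral_abs_R_bound by blast
  define G where "G = F * exp (F * X)"
  have G: "0 < G" using F_pos by (simp add: G_def)
  have "(\<integral>y. \<bar>K n x y\<bar> \<partial>\<mu>) \<le> C0 + G * H * X / (1 - q)" if x: "0 \<le> x" "x \<le> X * q ^ n" for n x
  proof -
    have le: "\<bar>K n x y\<bar> \<le> \<bar>K n 0 y\<bar> + (\<Sum>m\<le>n. G * (x / q ^ m) * (h m * \<bar>R m y\<bar>))" for y
    proof -
      have "K n x y - K n 0 y = (\<Sum>m\<le>n. (R m x - 1) * (h m * R m y))"
        unfolding K_def R_0_eq_1 sum_subtractf[symmetric]
        by (intro sum.cong) (simp_all only: algebra_simps mult_1_left)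
      also have "\<bar>\<dots>\<bar> \<le> (\<Sum>m\<le>n. G * (x / q ^ m) * (h m * \<bar>R m y\<bar>))"
      proof (intro order.trans[OF sum_abs] sum_mono)
        fix m assume "m \<in> {..n}"
        then have "X * q ^ n \<le> X * q ^ m"
          using X_pos q_pos q_less_1 by (intro mult_left_mono power_decreasing) auto
        then have "\<bar>R m x - 1\<bar> \<le> G * (x / q ^ m)"
          using R_le(2)[of x X m] x by (simp add: G_def mult_ac)
        then show "\<bar>(R m x - 1) * (h m * R m y)\<bar> \<le> G * (x / q ^ m) * (h m * \<bar>R m y\<bar>)"
          unfolding abs_mult using h_pos[of m] by (intro mult_mono) auto
      qed
      finally show ?thesis by linarith
    qed
    have "(\<integral>y. \<bar>K n x y\<bar> \<partial>\<mu>) \<le> (\<integral>y. \<bar>K n 0 y\<bar> \<partial>\<mu>) + (\<Sum>m\<le>n. G * (x / q ^ m) * H)"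
      using G x q_pos by (intro integral_K_le[OF H(1)] le) simp
    also have "\<dots> \<le> C0 + (\<Sum>m\<le>n. G * (x / q ^ m) * H)"
      by (intro add_right_mono C0)
    also have "(\<Sum>m\<le>n. G * (x / q ^ m) * H) \<le> G * H * X / (1 - q)"
    proof -
      have "(\<Sum>m\<le>n. x / q ^ m) \<le> (\<Sum>m\<le>n. X * q ^ (n - m))"
      proof (rule sum_mono)
        fix m assume "m \<in> {..n}"
        then show "x / q ^ m \<le> X * q ^ (n - m)"
          using x q_pos by (simp add: pos_divide_le_eq mult.assoc flip: power_add)
      qed
      also have "\<dots> = X * (\<Sum>m\<le>n. q ^ m)"
        unfolding sum_distrib_left
        by (rule sum.reindex_bij_witness[of _ "\<lambda>m. n - m" "\<lambda>m. n - m"], auto)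
      also have "(\<Sum>m\<le>n. q ^ m) \<le> 1 / (1 - q)"
        using q_pos q_less_1 by (simp add: sum_gp0 divide_right_mono)
      finally have "(\<Sum>m\<le>n. x / q ^ m) \<le> X * (1 / (1 - q))"
        using X_pos by (simp add: mult_left_mono)
      then have "G * H * (\<Sum>m\<le>n. x / q ^ m) \<le> G * H * (X * (1 / (1 - q)))"
        using G H(2) by (intro mult_left_mono) auto
      then show ?thesis by (simp add: sum_distrib_left mult_ac)
    qed
    finally show ?thesis by simp
  qed
  then show ?thesis by blast
qed

text \<open>The sum is cut at the last index \<open>k\<close> with \<open>x \<le> X * q ^ k\<close>:
  the terms up to \<open>k\<close> form a kernel of the previous kind, and beyond \<open>k\<close>
  the values \<open>R m x\<close> decay like powers of 1/2.\<close>

theorem Lebesgue_constant_bound: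
  "\<exists>C. \<forall>n. \<forall>x \<in> supp \<mu>. (\<integral>y. \<bar>K n x y\<bar> \<partial>\<mu>) \<le> C"
proof -
  obtain C0 where C0: "\<And>n x. 0 \<le> x \<Longrightarrow> x \<le> X * q ^ n \<Longrightarrow> (\<integral>y. \<bar>K n x y\<bar> \<partial>\<mu>) \<le> C0"
    using Lebesgue_constant_small_bound by blast
  obtain H where H: "\<And>n. h n * (\<integral>x. \<bar>R n x\<bar> \<partial>\<mu>) \<le> H" "0 < H"
    using integral_abs_R_bound by blast
  define G where "G = E * exp (F * (X / q)) * H"
  have G: "0 < G" using E_pos H by (simp add: G_def)
  have "(\<integral>y. \<bar>K n x y\<bar> \<partial>\<mu>) \<le> C0 + 2 * G" if x: "x \<in> supp \<mu>" for n x
  proof (cases "x \<le> X * q ^ n")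
    case True
    then show ?thesis using C0[OF supp_nonneg[OF x]] G by fastforce
  next
    case False
    \<comment> \<open>A crossing exists because the support lies below \<open>X\<close>, so the
      threshold is not exceeded at index 0.\<close>
    have "\<exists>k<n. x \<le> X * q ^ k \<and> X * q ^ Suc k < x"
      using False
    proof (induction n)
      case 0
      then show ?case using supp_le_X[OF x] by simp
    next
      case (Suc n)
      then show ?case by (metis less_Suc_eq not_le)
    qed
    then obtain k where k: "k < n" "x \<le> X * q ^ k" "X * q ^ Suc k < x" by blast
    \<comment> \<open>The decay starts at \<open>Suc k\<close>, one index past the bounded regime;
      there \<open>x \<le> (X / q) * q ^ Suc k\<close> still holds.\<close>
    have Rk: "\<bar>R (Suc k) x\<bar> \<le> exp (F * (X / q))"
      using k(2) q_pos by (intro R_le(1) supp_nonneg[OF x]) simp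
    have R: "\<bar>R m x\<bar> * H \<le> G * (1 / 2) ^ (m - Suc k)" if "Suc k \<le> m" for m
    proof -
      have "\<bar>R m x\<bar> \<le> E * \<bar>R (Suc k) x\<bar> * (1 / 2) ^ (m - Suc k)"
        by (rule R_decay[OF x k(3) that])
      also have "\<dots> \<le> E * exp (F * (X / q)) * (1 / 2) ^ (m - Suc k)"
        using E_pos Rk by (intro mult_right_mono mult_left_mono) auto
      finally have "\<bar>R m x\<bar> * H \<le> E * exp (F * (X / q)) * (1 / 2) ^ (m - Suc k) * H"
        using H(2) by (intro mult_right_mono) auto
      then show ?thesis by (simp only: G_def mult_ac)
    qed
    have split: "K n x y = K k x y + (\<Sum>m\<in>{Suc k..n}. R m x * R m y * h m)" for y
    proof -
      have "{..n} = {..k} \<union> {Suc k..n}" using k(1) by auto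
      then show ?thesis unfolding K_def by (simp only:) (intro sum.union_disjoint, auto)
    qed
    have le: "\<bar>K n x y\<bar> \<le> \<bar>K k x y\<bar> + (\<Sum>m\<in>{Suc k..n}. \<bar>R m x\<bar> * (h m * \<bar>R m y\<bar>))" for y
    proof -
      have "\<bar>\<Sum>m\<in>{Suc k..n}. R m x * R m y * h m\<bar> \<le> (\<Sum>m\<in>{Suc k..n}. \<bar>R m x\<bar> * (h m * \<bar>R m y\<bar>))"
        using h_pos by (intro order.trans[OF sum_abs] sum_mono) (simp add: abs_mult less_imp_le mult_ac)
      then show ?thesis unfolding split by linarith
    qed
    have "(\<integral>y. \<bar>K n x y\<bar> \<partial>\<mu>) \<le> (\<integral>y. \<bar>K k x y\<bar> \<partial>\<mu>) + (\<Sum>m\<in>{Suc k..n}. \<bar>R m x\<bar> * H)"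
      by (intro integral_K_le[OF H(1)] le) simp
    also have "\<dots> \<le> C0 + (\<Sum>m\<in>{Suc k..n}. \<bar>R m x\<bar> * H)"
      using k(2) by (intro add_right_mono C0 supp_nonneg[OF x])
    also have "(\<Sum>m\<in>{Suc k..n}. \<bar>R m x\<bar> * H) \<le> 2 * G"
    proof -
      have "(\<Sum>m\<in>{Suc k..n}. \<bar>R m x\<bar> * H) \<le> (\<Sum>m\<in>{Suc k..n}. G * (1 / 2) ^ (m - Suc k))"
        by (intro sum_mono R) auto
      also have "\<dots> = G * (\<Sum>j\<le>n - Suc k. (1 / 2) ^ j)"
        unfolding sum_distrib_left using k(1)
        by (intro sum.reindex_bij_witness[of _ "\<lambda>j. j + Suc k" "\<lambda>m. m - Suc k"]) auto
      also have "\<dots> \<le> G * 2"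
        using G by (intro mult_left_mono) (auto simp: sum_gp0)
      finally show ?thesis by simp
    qed
    finally show ?thesis by simp
  qed
  then show ?thesis by blast
qed

section \<open>Expansion of polynomials and their partial sums\<close>

text \<open>Each step of the recurrence multiplies the top coefficient by
  \<open>-1 / \<gamma> n\<close>, so it never vanishes; this makes the family a basis of the
  polynomials.\<close>

lemma degree_orth_poly:
  "degree (orth_poly \<alpha> \<gamma> n) \<le> n \<and> coeff (orth_poly \<alpha> \<gamma> n) n \<noteq> 0"
proof (induction n rule: less_induct)
  case (less n)
  consider "n = 0" | "n = Suc 0" | m where "n = Suc (Suc m)"
    by (metis not0_implies_Suc)
  then show ?case
  proof cases
    case 3
    have P: "degree (orth_poly \<alpha> \<gamma> (Suc m)) \<le> Suc m" "coeff (orth_poly \<alpha> \<gamma> (Suc m)) (Suc m) \<noteq> 0"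
      and Q: "degree (orth_poly \<alpha> \<gamma> m) \<le> m"
      using less[of "Suc m"] less[of m] 3 by auto
    have "degree ([:\<alpha> (Suc m) + \<gamma> (Suc m), -1:] * orth_poly \<alpha> \<gamma> (Suc m)) \<le> 1 + Suc m"
      by (intro order.trans[OF degree_mult_le] add_mono P(1)) simp
    moreover have "coeff (orth_poly \<alpha> \<gamma> (Suc m)) (Suc (Suc m)) = 0"
      "coeff (orth_poly \<alpha> \<gamma> m) (Suc (Suc m)) = 0"
      using P Q by (auto intro!: coeff_eq_0)
    ultimately show ?thesis
      unfolding 3 orth_poly.simps(3)
      using P(2) Q \<gamma>_pos[of "Suc m"]
      by (auto intro!: order.trans[OF degree_smult_le] degree_diff_le simp del: orth_poly.simps)
  qed (use \<gamma>_pos[of 0] in \<open>auto intro!: order.trans[OF degree_smult_le]\<close>)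
qed

text \<open>Subtracting the multiple of the top basis polynomial that cancels the leading
  coefficient lowers the degree bound by one.\<close>

lemma poly_expansion:
  "degree p \<le> n \<Longrightarrow> \<exists>c. \<forall>x. poly p x = (\<Sum>k\<le>n. c k * R k x)"
proof (induction n arbitrary: p)
  case 0
  then obtain a where "p = [:a:]" by (auto elim: degree_eq_zeroE)
  then show ?case by (intro exI[of _ "\<lambda>_. a"]) simp
next
  case (Suc n)
  let ?r = "orth_poly \<alpha> \<gamma> (Suc n)"
  define a where "a = coeff p (Suc n) / coeff ?r (Suc n)"
  define p' where "p' = p - smult a ?r"
  have "coeff p' (Suc n) = 0"
    using degree_orth_poly[of "Suc n"] by (simp del: orth_poly.simps add: p'_def a_def)
  moreover have "degree p' \<le> Suc n"
    unfolding p'_def using Suc.prems degree_orth_poly[of "Suc n"]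
    by (intro degree_diff_le order.trans[OF degree_smult_le]) auto
  ultimately have "degree p' \<le> n"
    by (metis le_SucE leading_coeff_0_iff degree_0 zero_le)
  then obtain c where c: "\<And>x. poly p' x = (\<Sum>k\<le>n. c k * R k x)"
    using Suc.IH by blast
  have "poly p x = (\<Sum>k\<le>Suc n. (c(Suc n := a)) k * R k x)" for x
  proof -
    have "poly p x = poly p' x + a * R (Suc n) x"
      by (simp del: orth_poly.simps add: p'_def)
    also have "poly p' x = (\<Sum>k\<le>n. (c(Suc n := a)) k * R k x)"
      unfolding c by (intro sum.cong) auto
    finally show ?thesis by (simp del: orth_poly.simps)
  qed
  then show ?case by blast
qed

text \<open>Each coordinate of \<open>g\<close> is a real polynomial and is expanded separately, up
  to a common degree bound \<open>N\<close>; the scalar coefficients are then collected into the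
  vectors \<open>d k\<close>.\<close>

lemma polynomial_function_expansion:
  fixes g :: "real \<Rightarrow> 'a::euclidean_space"
  assumes "polynomial_function g"
  shows "\<exists>N d. \<forall>y. g y = (\<Sum>k\<le>N. R k y *\<^sub>R d k)"
proof -
  have "\<exists>p. \<forall>y. g y \<bullet> v = poly p y" if "v \<in> Basis" for v
  proof -
    have "real_polynomial_function (\<lambda>y. g y \<bullet> v)"
      using assms that by (simp add: polynomial_function_iff_Basis_inner)
    then obtain a n where "(\<lambda>y. g y \<bullet> v) = (\<lambda>y. \<Sum>i\<le>n. a i * y ^ i)"
      by (auto simp: real_polynomial_function_iff_sum)
    then have "g y \<bullet> v = poly (\<Sum>i\<le>n. monom (a i) i) y" for y
      by (simp add: poly_sum poly_monom fun_eq_iff)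
    then show ?thesis by blast
  qed
  then obtain p where p: "\<And>v y. v \<in> Basis \<Longrightarrow> g y \<bullet> v = poly (p v) y"
    by metis
  define N where "N = (\<Sum>v\<in>Basis. degree (p v))"
  have "degree (p v) \<le> N" if "v \<in> Basis" for v
    unfolding N_def using that by (intro member_le_sum) auto
  then have "\<exists>c. \<forall>y. poly (p v) y = (\<Sum>k\<le>N. c k * R k y)" if "v \<in> Basis" for v
    using poly_expansion that by blast
  then obtain c where c: "\<And>v y. v \<in> Basis \<Longrightarrow> poly (p v) y = (\<Sum>k\<le>N. c v k * R k y)"
    by metis
  have "g y = (\<Sum>k\<le>N. R k y *\<^sub>R (\<Sum>v\<in>Basis. c v k *\<^sub>R v))" for y
  proof -
    have "g y = (\<Sum>v\<in>Basis. (g y \<bullet> v) *\<^sub>R v)"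
      by (rule euclidean_representation[symmetric])
    also have "\<dots> = (\<Sum>v\<in>Basis. \<Sum>k\<le>N. (c v k * R k y) *\<^sub>R v)"
      by (intro sum.cong refl) (simp only: p c scaleR_sum_left)
    also have "\<dots> = (\<Sum>k\<le>N. \<Sum>v\<in>Basis. (c v k * R k y) *\<^sub>R v)"
      by (rule sum.swap)
    finally show ?thesis by (simp add: scaleR_sum_right mult.commute)
  qed
  then show ?thesis by (intro exI allI)
qed

lemma supp_sets [measurable]: "supp \<mu> \<in> sets borel"
  using supp_complement_null(2)[OF sets_\<mu>] by simp

text \<open>Restriction to the support changes only a null set, and orthogonality leaves the term
  with index \<open>j\<close>, where the squared norm of \<open>R j\<close> is
  \<open>1 / h j\<close>.\<close>

lemma fourier_coeff_expansion:
  fixes d :: "nat \<Rightarrow> 'a::{real_normed_field,euclidean_space}"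
  shows "fourier_coeff \<alpha> \<gamma> \<mu> (\<lambda>y. \<Sum>k\<le>N. R k y *\<^sub>R d k) j = (if j \<le> N then d j /\<^sub>R h j else 0)"
proof -
  let ?g = "\<lambda>y. \<Sum>k\<le>N. (R k y * R j y) *\<^sub>R d k"
  have [measurable]: "R k \<in> borel_measurable borel" for k
    by (intro borel_measurable_continuous_onI continuous_intros)
  have "fourier_coeff \<alpha> \<gamma> \<mu> (\<lambda>y. \<Sum>k\<le>N. R k y *\<^sub>R d k) j
      = (\<integral>y. indicator (supp \<mu>) y *\<^sub>R ?g y \<partial>\<mu>)"
    unfolding fourier_coeff_def set_lebesgue_integral_def
    unfolding sum_distrib_right
    by (intro Bochner_Integration.integral_cong refl arg_cong2[where f = scaleR] sum.cong)
      (simp add: scaleR_conv_of_real mult_ac)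
  also have "\<dots> = (\<integral>y. ?g y \<partial>\<mu>)"
    using AE_supp by (intro integral_cong_AE) (measurable, auto elim!: eventually_mono)
  also have "\<dots> = (\<Sum>k\<le>N. \<integral>y. (R k y * R j y) *\<^sub>R d k \<partial>\<mu>)"
    by (intro Bochner_Integration.integral_sum integrable_scaleR_left integrable_R_mult)
  also have "\<dots> = (\<Sum>k\<le>N. (if k = j then 1 / h k else 0) *\<^sub>R d k)"
  proof (intro sum.cong refl)
    fix k
    have "(\<integral>y. R k y * R j y \<partial>\<mu>) = (if k = j then 1 / h k else 0)"
      by (rule has_bochner_integral_integral_eq[OF has_integral_R_mult])
    then show "(\<integral>y. (R k y * R j y) *\<^sub>R d k \<partial>\<mu>) = (if k = j then 1 / h k else 0) *\<^sub>R d k"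
      using integrable_R_mult[of k j] by simp
  qed
  also have "\<dots> = (\<Sum>k\<le>N. if k = j then d k /\<^sub>R h k else 0)"
    by (intro sum.cong) (auto simp: divide_inverse)
  finally show ?thesis by simp
qed

text \<open>The weights in the partial sum cancel the factors \<open>1 / h k\<close> of the
  coefficients, so long enough partial sums reproduce polynomials exactly.\<close>

lemma partial_sum_expansion:
  fixes d :: "nat \<Rightarrow> 'a::{real_normed_field,euclidean_space}"
  assumes "N \<le> n"
  shows "partial_sum \<alpha> \<gamma> \<mu> (\<lambda>y. \<Sum>k\<le>N. R k y *\<^sub>R d k) n x = (\<Sum>k\<le>N. R k x *\<^sub>R d k)"
proof -
  have "partial_sum \<alpha> \<gamma> \<mu> (\<lambda>y. \<Sum>k\<le>N. R k y *\<^sub>R d k) n x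
      = (\<Sum>k\<le>n. if k \<le> N then R k x *\<^sub>R d k else 0)"
    unfolding partial_sum_def fourier_coeff_expansion unfolding atMost_atLeast0
  proof (intro sum.cong refl)
    fix k
    have "h k \<noteq> 0" using h_pos[of k] by simp
    then show "(if k \<le> N then d k /\<^sub>R h k else 0) * of_real (R k x) * of_real (h k)
        = (if k \<le> N then R k x *\<^sub>R d k else 0)"
      by (simp add: scaleR_conv_of_real of_real_inverse)
  qed
  also have "\<dots> = (\<Sum>k\<le>N. R k x *\<^sub>R d k)"
    using assms by (intro sum.mono_neutral_cong_right) auto
  finally show ?thesis .
qed

section \<open>Partial sums as integral operators, and uniform convergence\<close>

lemma integrable_continuous_on_supp:
  fixes w :: "real \<Rightarrow> 'a::{real_normed_field,euclidean_space}"
  assumes "continuous_on (supp \<mu>) w"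
  shows "integrable \<mu> (\<lambda>y. indicator (supp \<mu>) y *\<^sub>R w y)"
proof -
  have "bounded (w ` supp \<mu>)"
    by (intro compact_imp_bounded compact_continuous_image assms compact_supp)
  then obtain M where M: "\<And>y. y \<in> supp \<mu> \<Longrightarrow> norm (w y) \<le> M"
    by (auto simp: bounded_iff)
  show ?thesis
  proof (rule integrable_const_bound)
    show "AE y in \<mu>. norm (indicator (supp \<mu>) y *\<^sub>R w y) \<le> M"
      using AE_supp by eventually_elim (simp add: M)
    show "(\<lambda>y. indicator (supp \<mu>) y *\<^sub>R w y) \<in> borel_measurable \<mu>"
      using borel_measurable_continuous_on_indicator[OF supp_sets assms]
      by (simp add: measurable_cong_sets[OF sets_\<mu> refl])
  qed
qed

lemma integrable_mult_R_on_supp: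
  fixes w :: "real \<Rightarrow> 'a::{real_normed_field,euclidean_space}"
  assumes "continuous_on (supp \<mu>) w"
  shows "integrable \<mu> (\<lambda>y. indicator (supp \<mu>) y *\<^sub>R (w y * of_real (R k y)))"
  by (intro integrable_continuous_on_supp continuous_intros assms)

lemma partial_sum_diff:
  fixes f g :: "real \<Rightarrow> 'a::{real_normed_field,euclidean_space}"
  assumes "continuous_on (supp \<mu>) f" "continuous_on (supp \<mu>) g"
  shows "partial_sum \<alpha> \<gamma> \<mu> (\<lambda>y. f y - g y) n x
       = partial_sum \<alpha> \<gamma> \<mu> f n x - partial_sum \<alpha> \<gamma> \<mu> g n x"
proof -
  have "fourier_coeff \<alpha> \<gamma> \<mu> (\<lambda>y. f y - g y) k
      = fourier_coeff \<alpha> \<gamma> \<mu> f k - fourier_coeff \<alpha> \<gamma> \<mu> g k" for k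
    unfolding fourier_coeff_def set_lebesgue_integral_def
    using Bochner_Integration.integral_diff[OF integrable_mult_R_on_supp[OF assms(1), of k]
        integrable_mult_R_on_supp[OF assms(2), of k]]
    by (simp only: left_diff_distrib scaleR_diff_right)
  then show ?thesis
    by (simp only: partial_sum_def left_diff_distrib sum_subtractf)
qed

text \<open>Exchanging the finite sum with the integral writes the partial sum as the integral of
  \<open>w\<close> against the kernel \<open>K n x\<close>.\<close>

lemma norm_partial_sum_le:
  fixes w :: "real \<Rightarrow> 'a::{real_normed_field,euclidean_space}"
  assumes w: "continuous_on (supp \<mu>) w" and le: "\<And>y. y \<in> supp \<mu> \<Longrightarrow> norm (w y) \<le> e"
    and "0 \<le> e"
  shows "norm (partial_sum \<alpha> \<gamma> \<mu> w n x) \<le> e * (\<integral>y. \<bar>K n x y\<bar> \<partial>\<mu>)"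
proof -
  let ?F = "\<lambda>k y. indicator (supp \<mu>) y *\<^sub>R (w y * of_real (R k y))"
  let ?c = "\<lambda>k. of_real (R k x) * of_real (h k) :: 'a"
  have "partial_sum \<alpha> \<gamma> \<mu> w n x = (\<Sum>k\<le>n. (\<integral>y. ?F k y \<partial>\<mu>) * ?c k)"
    by (simp only: partial_sum_def fourier_coeff_def set_lebesgue_integral_def atMost_atLeast0 mult.assoc)
  also have "\<dots> = (\<integral>y. (\<Sum>k\<le>n. ?F k y * ?c k) \<partial>\<mu>)"
  proof -
    have "integrable \<mu> (\<lambda>y. ?F k y * ?c k)" for k
      by (rule integrable_mult_left, rule integrable_mult_R_on_supp[OF w])
    then show ?thesis
      by (simp only: Bochner_Integration.integral_sum integral_mult_left_zero)
  qed
  also have "\<dots> = (\<integral>y. indicator (supp \<mu>) y *\<^sub>R (w y * of_real (K n x y)) \<partial>\<mu>)"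
    by (intro Bochner_Integration.integral_cong refl)
      (simp add: K_def sum_distrib_left sum_distrib_right scaleR_sum_right mult_ac)
  also have "norm \<dots> \<le> (\<integral>y. e * \<bar>K n x y\<bar> \<partial>\<mu>)"
  proof (rule Bochner_Integration.integral_norm_bound_integral)
    have "continuous_on (supp \<mu>) (K n x)"
      unfolding K_def by (intro continuous_intros)
    then show "integrable \<mu> (\<lambda>y. indicator (supp \<mu>) y *\<^sub>R (w y * of_real (K n x y)))"
      by (intro integrable_continuous_on_supp continuous_intros w)
    show "integrable \<mu> (\<lambda>y. e * \<bar>K n x y\<bar>)"
      using integrable_K[of n x] by simp
    show "norm (indicator (supp \<mu>) y *\<^sub>R (w y * of_real (K n x y))) \<le> e * \<bar>K n x y\<bar>" for y
      using le[of y] \<open>0 \<le> e\<close>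
      by (cases "y \<in> supp \<mu>") (auto simp: norm_mult intro: mult_right_mono)
  qed
  also have "\<dots> = e * (\<integral>y. \<bar>K n x y\<bar> \<partial>\<mu>)" by simp
  finally show ?thesis .
qed

text \<open>A polynomial \<open>g\<close> close to \<open>f\<close> is reproduced for large
  \<open>n\<close>, so the error is at most that of applying the partial sum to \<open>f - g\<close>
  plus the distance of \<open>f\<close> from \<open>g\<close>.\<close>

theorem uniform_convergence:
  fixes f :: "real \<Rightarrow> 'a::{real_normed_field,euclidean_space}"
  assumes f: "continuous_on (supp \<mu>) f"
  shows "uniform_limit (supp \<mu>) (partial_sum \<alpha> \<gamma> \<mu> f) f sequentially"
proof (rule uniform_limitI)
  fix e :: real assume e: "0 < e"
  obtain L where L: "\<And>n x. x \<in> supp \<mu> \<Longrightarrow> (\<integral>y. \<bar>K n x y\<bar> \<partial>\<mu>) \<le> L"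
    using Lebesgue_constant_bound by blast
  \<comment> \<open>The operator bound contributes \<open>\<bar>L\<bar>\<close> and the
    approximation itself contributes 1.\<close>
  define \<delta> where "\<delta> = e / (\<bar>L\<bar> + 1)"
  have \<delta>: "0 < \<delta>" "\<delta> * (\<bar>L\<bar> + 1) = e"
    using e by (auto simp: \<delta>_def)
  obtain g where g: "polynomial_function g" "\<And>x. x \<in> supp \<mu> \<Longrightarrow> norm (f x - g x) < \<delta>"
    using Stone_Weierstrass_polynomial_function[OF compact_supp f \<delta>(1)] by blast
  obtain N d where d: "\<And>y. g y = (\<Sum>k\<le>N. R k y *\<^sub>R d k)"
    using polynomial_function_expansion[OF g(1)] by blast
  have geq: "g = (\<lambda>y. \<Sum>k\<le>N. R k y *\<^sub>R d k)" by (rule ext) (rule d)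
  have cg: "continuous_on (supp \<mu>) g"
    by (rule continuous_on_polymonial_function[OF g(1)])
  have "dist (partial_sum \<alpha> \<gamma> \<mu> f n x) (f x) < e" if n: "N \<le> n" and x: "x \<in> supp \<mu>" for n x
  proof -
    have fix_g: "partial_sum \<alpha> \<gamma> \<mu> g n x = g x"
      unfolding geq by (rule partial_sum_expansion[OF n])
    have "norm (partial_sum \<alpha> \<gamma> \<mu> (\<lambda>y. f y - g y) n x) \<le> \<delta> * (\<integral>y. \<bar>K n x y\<bar> \<partial>\<mu>)"
      using g(2) \<delta>(1) by (intro norm_partial_sum_le continuous_intros f cg) (auto simp: less_imp_le)
    also have "\<dots> \<le> \<delta> * \<bar>L\<bar>"
      using L[OF x, of n] \<delta>(1) by (intro mult_left_mono) auto
    finally have "norm (partial_sum \<alpha> \<gamma> \<mu> f n x - g x) \<le> \<delta> * \<bar>L\<bar>"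
      by (simp only: partial_sum_diff[OF f cg] fix_g)
    moreover have "norm (f x - g x) < \<delta>" by (rule g(2)[OF x])
    moreover have "dist (partial_sum \<alpha> \<gamma> \<mu> f n x) (f x)
        \<le> norm (partial_sum \<alpha> \<gamma> \<mu> f n x - g x) + norm (f x - g x)"
      by (metis dist_norm dist_triangle2)
    ultimately show ?thesis using \<delta>(2) by (simp add: distrib_left)
  qed
  then show "\<forall>\<^sub>F n in sequentially. \<forall>x\<in>supp \<mu>. dist (partial_sum \<alpha> \<gamma> \<mu> f n x) (f x) < e"
    unfolding eventually_sequentially by blast
qed

end

section \<open>From the asymptotic hypotheses to explicit inequalities\<close>

lemma ratio_converges_upper:
  assumes "ratio_converges g (\<lambda>n. q ^ n)" and "0 < (q :: real)"
  shows "\<exists>A. \<forall>n. g n \<le> A * q ^ n"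
proof -
  have "Bseq (\<lambda>n. g n / q ^ n)"
    using assms(1) unfolding ratio_converges_def by (meson convergentI convergent_imp_Bseq)
  then obtain A where "\<And>n. norm (g n / q ^ n) \<le> A"
    by (auto simp: Bseq_def)
  then have "g n / q ^ n \<le> A" for n
    using abs_ge_self order.trans unfolding real_norm_def by blast
  then show ?thesis
    using assms(2) by (intro exI[of _ A]) (simp add: pos_divide_le_eq)
qed

text \<open>The limit is nonzero, so the inverse ratios converge and are bounded; positivity of
  \<open>g\<close> at every index makes the resulting bound hold for all \<open>n\<close>.\<close>

lemma ratio_converges_lower:
  assumes "ratio_converges g (\<lambda>n. q ^ n)" and "0 < (q :: real)" and "\<And>n. 0 < g n"
  shows "\<exists>a>0. \<forall>n. a * q ^ n \<le> g n"
proof -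
  obtain L where L: "L > 0" "(\<lambda>n. g n / q ^ n) \<longlonglongrightarrow> L"
    using assms(1) by (auto simp: ratio_converges_def)
  then have "(\<lambda>n. inverse (g n / q ^ n)) \<longlonglongrightarrow> inverse L"
    by (intro tendsto_inverse) auto
  then have "Bseq (\<lambda>n. inverse (g n / q ^ n))"
    by (meson convergentI convergent_imp_Bseq)
  then obtain A where A: "0 < A" "\<And>n. norm (inverse (g n / q ^ n)) \<le> A"
    by (auto simp: Bseq_def)
  have "1 / A * q ^ n \<le> g n" for n
  proof -
    have "q ^ n / g n \<le> A" using A(2)[of n] assms(2) assms(3)[of n] by simp
    then show ?thesis using A(1) assms(3)[of n] by (simp add: field_simps)
  qed
  then show ?thesis using A(1) by (intro exI[of _ "1 / A"]) simp
qed

theorem theorem2: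
  fixes \<alpha> \<gamma> \<beta> lam :: "nat \<Rightarrow> real"
    and q \<kappa> s c :: real and N :: nat
    and \<mu> :: "real measure"
    and f :: "real \<Rightarrow> 'a::{real_normed_field,euclidean_space}"
  assumes "\<alpha> 0 = 0"
    and "\<And>n. \<gamma> n > 0"
    and "\<And>n. \<alpha> (n + 1) > 0"
    and "\<And>n. \<beta> n = \<alpha> n + \<gamma> n"
    and "\<And>n. lam n = sqrt (\<alpha> (n + 1) * \<gamma> n)"
    and "ratio_converges \<alpha> (\<lambda>n. q ^ n)" and "ratio_converges \<gamma> (\<lambda>n. q ^ n)"
    and "0 < q" and "q < 1"
    and "\<And>n. \<alpha> n \<le> \<kappa> * \<gamma> n"
    and "1 \<le> \<kappa>" and "\<kappa> < 1 / q + q - 1"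
    and "ratio_bounded (weight \<alpha> \<gamma>) (\<lambda>n. s ^ n)" and "s > 1"
    and "\<And>n. lam n \<le> \<beta> (n + 1) - c * \<beta> (n + 2)"
    and "(1 + q) / (1 + q\<^sup>2) < c" and "c < 1 / q"
    and "\<beta> 1 \<le> \<beta> 0"
    and "\<And>n. n \<ge> N \<Longrightarrow> \<beta> n - c * \<beta> (n + 1) \<ge> \<beta> (n + 1) - c * \<beta> (n + 2)"
    and "orthogonality_measure \<alpha> \<gamma> \<mu>"
    and "continuous_on (supp \<mu>) f"
  shows "uniform_limit (supp \<mu>) (partial_sum \<alpha> \<gamma> \<mu> f) f sequentially"
proof -
  obtain A1 where A1: "\<And>n. \<alpha> n \<le> A1 * q ^ n"
    using ratio_converges_upper assms(6,8) by blast
  obtain A2 where A2: "\<And>n. \<gamma> n \<le> A2 * q ^ n"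
    using ratio_converges_upper assms(7,8) by blast
  obtain a where a: "0 < a" "\<And>n. a * q ^ n \<le> \<gamma> n"
    using ratio_converges_lower assms(2,7,8) by blast
  obtain b B where b: "0 < b" "\<And>n. b \<le> weight \<alpha> \<gamma> n / s ^ n" "\<And>n. weight \<alpha> \<gamma> n / s ^ n \<le> B"
    using assms(13) by (auto simp: ratio_bounded_def)
  \<comment> \<open>One constant \<open>A\<close> has to serve both coefficient sequences.\<close>
  have le_max: "A1 * q ^ n \<le> max A1 A2 * q ^ n" "A2 * q ^ n \<le> max A1 A2 * q ^ n" for n
    using assms(8) by (simp_all add: mult_right_mono)
  interpret geometric_recurrence \<alpha> \<gamma> q s "max A1 A2" a B b \<mu>
  proof
    show "\<alpha> n \<le> max A1 A2 * q ^ n" "\<gamma> n \<le> max A1 A2 * q ^ n" for n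
      using A1[of n] A2[of n] le_max[of n] by linarith+
    show "b * s ^ n \<le> weight \<alpha> \<gamma> n" "weight \<alpha> \<gamma> n \<le> B * s ^ n" for n
      using b(2,3)[of n] assms(14) by (simp_all add: pos_le_divide_eq pos_divide_le_eq)
  qed (use assms(1-3,8,9,14,20) a b(1) in auto)
  show ?thesis
    by (rule uniform_convergence[OF assms(21)])
qed

end
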